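(* Consider the generalized eigenvalue problem $A\psi_m=\lambda_m S\psi_m$ on $V$, with eigenvalues $\lambda_1\le\lambda_2\le\cdots$ arranged in ascending order, for the high-contrast network with contrast parameter $\xi\gg1$ and $N_{\mathrm{ch}}$ disconnected high-contrast inclusions or channels described in the context. Then $\lambda_m=O(1/\xi)$ for $m=1,2,\dots,N_{\mathrm{ch}}$, and $\lambda_m\ge C$ for $m\ge N_{\mathrm{ch}}+1$, with $C>0$ independent of $\xi$. That is, the number of small eigenvalues is determined by the number of disconnected high-contrast inclusions or channels, and the smallest contrast-independent eigenvalue is of order one.
   Context: $\mathcal G=(\mathcal N,\mathcal E)$ is a finite connected undirected graph, $x\sim y$ means $\{x,y\}\in\mathcal E$, and $V$ is the space of real-valued functions on $\mathcal N$ with Euclidean inner product $(\cdot,\cdot)$. There is a constant $\tilde C>0$ such that every node has at most $\tilde C$ neighbors. The node set is decomposed as $\mathcal N=\mathcal R_1\cup\mathcal R^\xi$, where $\mathcal R_1$ is the region not containing high-contrast structures and $\mathcal R^\xi=\bigcup_{m=1}^{N_{\mathrm{ch}}}\mathcal R^\xi_m$ consists of $N_{\mathrm{ch}}$ mutually disjoint subgraphs ($\mathcal R^\xi_i\cap\mathcal R^\xi_j=\varnothing$ for $i\ne j$), each representing a high-contrast inclusion or channel. The parameter $\xi\gg1$ characterizes the high-contrast structure. The edge weights satisfy $L_{xy}=1$ for all edges with $x\in\mathcal R_1$ (where $y$ may lie outside $\mathcal R_1$), and $C_L^{\inf}\xi\le L_{xy}\le C_L^{\sup}\xi$ for all edges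 $x\sim y$ with $x,y\in\mathcal R^\xi$, where $0<C_L^{\inf}\le C_L^{\sup}$ are constants independent of $\xi$. The sizes of the inclusions are independent of $\xi$, and the diameters of the $\mathcal R^\xi_m$ and of $\mathcal N$ are of $O(1)$. The node masses satisfy $0\le M_x\le\overline M<\infty$ with $\overline M$ a constant independent of $\xi$. Set $\tilde L_x=\frac12\sum_{y\sim x}L_{xy}$ and $$(Av,w)=\frac12\sum_{x\in\mathcal N}\sum_{y\sim x}L_{xy}(v(x)-v(y))(w(x)-w(y))+\sum_{x\in\mathcal N}M_xv(x)w(x),\qquad (Sv,w)=\sum_{x\in\mathcal N}(\tilde L_x+M_x)v(x)w(x).$$ The operator $A$ is assumed to be symmetric positive definite on $V$. *)

theory Defs
  imports "HOL-Analysis.Analysis" "HOL-Library.Function_Algebras"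
begin

text \<open>
  The library provides the pointwise group structure on functions, but not the pointwise
  real vector space structure; the latter makes \<open>dim\<close> available for spaces of functions.
\<close>

instantiation "fun" :: (type, real_vector) real_vector
begin

definition scaleR_fun :: "real \<Rightarrow> ('a \<Rightarrow> 'b) \<Rightarrow> 'a \<Rightarrow> 'b"
  where "scaleR_fun c f = (\<lambda>x. c *\<^sub>R f x)"

instance
  by standard (simp_all add: scaleR_fun_def fun_eq_iff scaleR_add_right scaleR_add_left)

end

lemma scaleR_fun_apply [simp]: "(c *\<^sub>R f) x = c *\<^sub>R f x"
  by (simp add: scaleR_fun_def)


section \<open>Node functions and operators given by bilinear forms\<close>

text \<open>
  The space \<open>V\<close> of real functions on a finite node set \<open>N\<close> is encoded by the functions on the
  ambient type that vanish outside \<open>N\<close>.  In this way the node set may vary within a statement.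
\<close>

definition node_funs :: "'a set \<Rightarrow> ('a \<Rightarrow> real) set"
  where "node_funs N = {v. \<forall>x. x \<notin> N \<longrightarrow> v x = 0}"

definition ip :: "'a set \<Rightarrow> ('a \<Rightarrow> real) \<Rightarrow> ('a \<Rightarrow> real) \<Rightarrow> real"
  where "ip N v w = (\<Sum>x\<in>N. v x * w x)"

text \<open>The operator \<open>T\<close> on \<open>V\<close> determined by \<open>(T v, w) = a v w\<close> for all \<open>w\<close> in \<open>V\<close>.\<close>

definition form_op ::
  "'a set \<Rightarrow> (('a \<Rightarrow> real) \<Rightarrow> ('a \<Rightarrow> real) \<Rightarrow> real) \<Rightarrow> ('a \<Rightarrow> real) \<Rightarrow> ('a \<Rightarrow> real)"
  where "form_op N a v = (THE u. u \<in> node_funs N \<and> (\<forall>w\<in>node_funs N. ip N u w = a v w))"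

lemma ex1_form_representative:
  assumes fin: "finite N" and lin: "linear (a v)"
  shows "\<exists>!u. u \<in> node_funs N \<and> (\<forall>w\<in>node_funs N. ip N u w = a v w)"
proof -
  define d :: "'a \<Rightarrow> 'a \<Rightarrow> real" where "d z = (\<lambda>x. if x = z then 1 else 0)" for z
  have d_in: "d z \<in> node_funs N" if "z \<in> N" for z
    using that by (auto simp: node_funs_def d_def)
  have ip_d: "ip N u (d z) = u z" if "z \<in> N" for u z
    using that fin by (simp add: ip_def d_def if_distrib cong: if_cong)
  have sum_app: "(\<Sum>z\<in>B. f z) x = (\<Sum>z\<in>B. f z x)"
    for f :: "'a \<Rightarrow> 'a \<Rightarrow> real" and B x
    by (induction B rule: infinite_finite_induct) auto
  have expand: "w = (\<Sum>z\<in>N. w z *\<^sub>R d z)" if "w \<in> node_funs N" for w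
  proof
    fix x
    show "w x = (\<Sum>z\<in>N. w z *\<^sub>R d z) x"
      using that fin by (auto simp: sum_app d_def node_funs_def if_distrib cong: if_cong)
  qed
  define g where "g x = (if x \<in> N then a v (d x) else 0)" for x
  have g_in: "g \<in> node_funs N"
    by (simp add: node_funs_def g_def)
  have g_rep: "ip N g w = a v w" if w: "w \<in> node_funs N" for w
  proof -
    have "a v w = a v (\<Sum>z\<in>N. w z *\<^sub>R d z)"
      using expand[OF w] by simp
    also have "\<dots> = (\<Sum>z\<in>N. w z * a v (d z))"
      using lin by (simp add: linear_sum linear_scale)
    also have "\<dots> = ip N g w"
      by (simp add: ip_def g_def mult.commute)
    finally show ?thesis by simp
  qed
  show ?thesis
  proof (rule ex1I[of _ g])
    show "g \<in> node_funs N \<and> (\<forall>w\<in>node_funs N. ip N g w = a v w)"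
      using g_in g_rep by blast
  next
    fix u assume u: "u \<in> node_funs N \<and> (\<forall>w\<in>node_funs N. ip N u w = a v w)"
    show "u = g"
    proof
      fix x
      show "u x = g x"
      proof (cases "x \<in> N")
        case True
        then show ?thesis
          using u d_in[OF True] ip_d[OF True, of u] by (simp add: g_def)
      next
        case False
        then show ?thesis using u by (simp add: node_funs_def g_def)
      qed
    qed
  qed
qed

lemma form_op:
  assumes "finite N" and "linear (a v)"
  shows form_op_in: "form_op N a v \<in> node_funs N"
    and form_op_ip: "w \<in> node_funs N \<Longrightarrow> ip N (form_op N a v) w = a v w"
  using theI'[OF ex1_form_representative[of N a v, OF assms]]
  by (auto simp: form_op_def)

definition spd_on :: "'a set \<Rightarrow> (('a \<Rightarrow> real) \<Rightarrow> ('a \<Rightarrow> real)) \<Rightarrow> bool"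
  where "spd_on N T \<longleftrightarrow>
    (\<forall>v\<in>node_funs N. \<forall>w\<in>node_funs N. ip N (T v) w = ip N v (T w)) \<and>
    (\<forall>v\<in>node_funs N. v \<noteq> 0 \<longrightarrow> ip N (T v) v > 0)"


section \<open>Generalized eigenvalues\<close>

definition gen_eigenspace ::
  "'a set \<Rightarrow> (('a \<Rightarrow> real) \<Rightarrow> ('a \<Rightarrow> real)) \<Rightarrow> (('a \<Rightarrow> real) \<Rightarrow> ('a \<Rightarrow> real)) \<Rightarrow> real \<Rightarrow> ('a \<Rightarrow> real) set"
  where "gen_eigenspace N A S t = {\<psi>\<in>node_funs N. A \<psi> = t *\<^sub>R S \<psi>}"

definition gen_eigenvalues ::
  "'a set \<Rightarrow> (('a \<Rightarrow> real) \<Rightarrow> ('a \<Rightarrow> real)) \<Rightarrow> (('a \<Rightarrow> real) \<Rightarrow> ('a \<Rightarrow> real)) \<Rightarrow> real set"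
  where "gen_eigenvalues N A S = {t. \<exists>\<psi>\<in>gen_eigenspace N A S t. \<psi> \<noteq> 0}"

text \<open>
  All generalized eigenvalues in ascending order, each repeated according to its multiplicity,
  and the \<open>m\<close>-th of them, where \<open>m\<close> starts from 1.
\<close>

definition gen_eigenvalue_list ::
  "'a set \<Rightarrow> (('a \<Rightarrow> real) \<Rightarrow> ('a \<Rightarrow> real)) \<Rightarrow> (('a \<Rightarrow> real) \<Rightarrow> ('a \<Rightarrow> real)) \<Rightarrow> real list"
  where "gen_eigenvalue_list N A S =
    concat (map (\<lambda>t. replicate (dim (gen_eigenspace N A S t)) t)
      (sorted_list_of_set (gen_eigenvalues N A S)))"

definition gen_eigenvalue ::
  "'a set \<Rightarrow> (('a \<Rightarrow> real) \<Rightarrow> ('a \<Rightarrow> real)) \<Rightarrow> (('a \<Rightarrow> real) \<Rightarrow> ('a \<Rightarrow> real)) \<Rightarrow> nat \<Rightarrow> real"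
  where "gen_eigenvalue N A S m = gen_eigenvalue_list N A S ! (m - 1)"


section \<open>Graphs\<close>

text \<open>A graph has a node set \<open>N\<close> and a set \<open>E\<close> of two-element sets of nodes as edges.\<close>

definition nbrs :: "'a set set \<Rightarrow> 'a \<Rightarrow> 'a set"
  where "nbrs E x = {y. {x, y} \<in> E}"

text \<open>The adjacency relation of the subgraph induced by a set \<open>R\<close> of nodes.\<close>

definition adj :: "'a set set \<Rightarrow> 'a set \<Rightarrow> ('a \<times> 'a) set"
  where "adj E R = {(x, y). x \<in> R \<and> y \<in> R \<and> {x, y} \<in> E}"

definition graph_connected :: "'a set set \<Rightarrow> 'a set \<Rightarrow> bool"
  where "graph_connected E R \<longleftrightarrow> R \<noteq> {} \<and> (\<forall>x\<in>R. \<forall>y\<in>R. (x, y) \<in> (adj E R)\<^sup>*)"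

text \<open>Distance and diameter are only used for finite connected \<open>R\<close>.\<close>

definition graph_dist :: "'a set set \<Rightarrow> 'a set \<Rightarrow> 'a \<Rightarrow> 'a \<Rightarrow> nat"
  where "graph_dist E R x y = (LEAST k. (x, y) \<in> adj E R ^^ k)"

definition graph_diam :: "'a set set \<Rightarrow> 'a set \<Rightarrow> nat"
  where "graph_diam E R = Max ((\<lambda>(x, y). graph_dist E R x y) ` (R \<times> R))"


section \<open>The operators \<open>A\<close> and \<open>S\<close> of a weighted network\<close>

definition A_form ::
  "'a set \<Rightarrow> 'a set set \<Rightarrow> ('a \<Rightarrow> 'a \<Rightarrow> real) \<Rightarrow> ('a \<Rightarrow> real) \<Rightarrow> ('a \<Rightarrow> real) \<Rightarrow> ('a \<Rightarrow> real) \<Rightarrow> real"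
  where "A_form N E L M v w =
    1/2 * (\<Sum>x\<in>N. \<Sum>y\<in>nbrs E x. L x y * (v x - v y) * (w x - w y)) + (\<Sum>x\<in>N. M x * v x * w x)"

definition Ltilde :: "'a set set \<Rightarrow> ('a \<Rightarrow> 'a \<Rightarrow> real) \<Rightarrow> 'a \<Rightarrow> real"
  where "Ltilde E L x = 1/2 * (\<Sum>y\<in>nbrs E x. L x y)"

definition S_form ::
  "'a set \<Rightarrow> 'a set set \<Rightarrow> ('a \<Rightarrow> 'a \<Rightarrow> real) \<Rightarrow> ('a \<Rightarrow> real) \<Rightarrow> ('a \<Rightarrow> real) \<Rightarrow> ('a \<Rightarrow> real) \<Rightarrow> real"
  where "S_form N E L M v w = (\<Sum>x\<in>N. (Ltilde E L x + M x) * v x * w x)"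

definition A_op ::
  "'a set \<Rightarrow> 'a set set \<Rightarrow> ('a \<Rightarrow> 'a \<Rightarrow> real) \<Rightarrow> ('a \<Rightarrow> real) \<Rightarrow> ('a \<Rightarrow> real) \<Rightarrow> ('a \<Rightarrow> real)"
  where "A_op N E L M = form_op N (A_form N E L M)"

definition S_op ::
  "'a set \<Rightarrow> 'a set set \<Rightarrow> ('a \<Rightarrow> 'a \<Rightarrow> real) \<Rightarrow> ('a \<Rightarrow> real) \<Rightarrow> ('a \<Rightarrow> real) \<Rightarrow> ('a \<Rightarrow> real)"
  where "S_op N E L M = form_op N (S_form N E L M)"

lemma linear_A_form: "linear (A_form N E L M v)"
proof (rule linearI)
  fix w w' :: "'a \<Rightarrow> real" and c :: real
  have "L x y * (v x - v y) * (w x + w' x - (w y + w' y)) =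
      L x y * (v x - v y) * (w x - w y) + L x y * (v x - v y) * (w' x - w' y)" for x y
    by (simp add: algebra_simps)
  then show "A_form N E L M v (w + w') = A_form N E L M v w + A_form N E L M v w'"
    by (simp add: A_form_def sum.distrib distrib_left)
  show "A_form N E L M v (c *\<^sub>R w) = c *\<^sub>R A_form N E L M v w"
    by (simp add: A_form_def sum_distrib_left algebra_simps)
qed

lemma linear_S_form: "linear (S_form N E L M v)"
  by (rule linearI) (simp_all add: S_form_def sum.distrib distrib_left sum_distrib_left mult_ac)

lemma A_op:
  assumes "finite N"
  shows "A_op N E L M v \<in> node_funs N"
    and "w \<in> node_funs N \<Longrightarrow> ip N (A_op N E L M v) w = A_form N E L M v w"
  unfolding A_op_def by (simp_all add: form_op[OF assms linear_A_form])

lemma S_op: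
  assumes "finite N"
  shows "S_op N E L M v \<in> node_funs N"
    and "w \<in> node_funs N \<Longrightarrow> ip N (S_op N E L M v) w = S_form N E L M v w"
  unfolding S_op_def by (simp_all add: form_op[OF assms linear_S_form])


section \<open>High-contrast networks\<close>

text \<open>
  The bounds \<open>Ct\<close> (number of neighbors), \<open>D\<close> (diameters), \<open>K\<close> (sizes of the inclusions),
  \<open>CLinf\<close>, \<open>CLsup\<close> (weights) and \<open>Mbar\<close> (masses) are the constants independent of \<open>\<xi>\<close>.
  A single inclusion or channel is a connected subgraph that contains an edge, and distinct
  inclusions are disconnected from each other, i.e. not joined by an edge: an isolated node
  carries no high-contrast weight, and two inclusions joined by an edge of weight of order
  \<open>\<xi>\<close> form a single connected inclusion.
\<close>

locale high_contrast_network =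
  fixes Ct :: real and D K :: nat and CLinf CLsup Mbar :: real
    and \<xi> :: real
    and N :: "'a set" and E :: "'a set set"
    and R1 :: "'a set" and Nch :: nat and R :: "nat \<Rightarrow> 'a set"
    and L :: "'a \<Rightarrow> 'a \<Rightarrow> real" and M :: "'a \<Rightarrow> real"
  assumes finite_nodes: "finite N"
    and edges: "E \<subseteq> {{x, y} | x y. x \<in> N \<and> y \<in> N \<and> x \<noteq> y}"
    and connected_network: "graph_connected E N"
    and nbrs_bound: "\<And>x. x \<in> N \<Longrightarrow> real (card (nbrs E x)) \<le> Ct"
    and Nch_pos: "1 \<le> Nch"
    and decomposition: "N = R1 \<union> (\<Union>i\<in>{1..Nch}. R i)" "R1 \<inter> (\<Union>i\<in>{1..Nch}. R i) = {}"
    and disjoint_inclusions: "\<And>i j. i \<in> {1..Nch} \<Longrightarrow> j \<in> {1..Nch} \<Longrightarrow> i \<noteq> j \<Longrightarrow> R i \<inter> R j = {}"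
    and disconnected_inclusions:
      "\<And>i j x y. i \<in> {1..Nch} \<Longrightarrow> j \<in> {1..Nch} \<Longrightarrow> i \<noteq> j \<Longrightarrow> x \<in> R i \<Longrightarrow> y \<in> R j \<Longrightarrow> {x, y} \<notin> E"
    and connected_inclusion: "\<And>i. i \<in> {1..Nch} \<Longrightarrow> graph_connected E (R i)"
    and inclusion_has_edge: "\<And>i. i \<in> {1..Nch} \<Longrightarrow> \<exists>e\<in>E. e \<subseteq> R i"
    and inclusion_size: "\<And>i. i \<in> {1..Nch} \<Longrightarrow> card (R i) \<le> K"
    and inclusion_diam: "\<And>i. i \<in> {1..Nch} \<Longrightarrow> graph_diam E (R i) \<le> D"
    and network_diam: "graph_diam E N \<le> D"
    and weights_sym: "\<And>x y. {x, y} \<in> E \<Longrightarrow> L x y = L y x"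
    and weights_R1: "\<And>x y. {x, y} \<in> E \<Longrightarrow> x \<in> R1 \<Longrightarrow> L x y = 1"
    and weights_high:
      "\<And>x y. {x, y} \<in> E \<Longrightarrow> x \<in> (\<Union>i\<in>{1..Nch}. R i) \<Longrightarrow> y \<in> (\<Union>i\<in>{1..Nch}. R i) \<Longrightarrow>
        CLinf * \<xi> \<le> L x y \<and> L x y \<le> CLsup * \<xi>"
    and masses: "\<And>x. x \<in> N \<Longrightarrow> 0 \<le> M x \<and> M x \<le> Mbar"
    and A_spd: "spd_on N (A_op N E L M)"

end

theory Submission
  imports Defs
begin

text \<open>
  The eigenvalues are the critical values of the Rayleigh quotient \<open>(A v, v) / (S v, v)\<close>, so each
  bound comes from one subspace and the min-max principle.

  \<^item> Upper bound \<open>O(1/\<xi>)\<close>. The indicator functions of the \<open>Nch\<close> inclusions span a space on which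
    no edge of weight of order \<open>\<xi>\<close> contributes to \<open>(A v, v)\<close>, because such an edge stays inside
    one inclusion, where \<open>v\<close> is constant. On the other hand every node of an inclusion has a
    neighbor inside it, which makes its weight in \<open>(S v, v)\<close> of order \<open>\<xi>\<close>
    (\<open>inclusion_constant_rayleigh\<close>).

  \<^item> Lower bound. Requiring \<open>v\<close> to vanish at one chosen node of each inclusion imposes \<open>Nch\<close>
    linear conditions. Under them the difference of \<open>v\<close> along a path from a chosen node
    inside an inclusion costs energy of order \<open>\<xi>\<close> times its square, which matches the weight of
    order \<open>\<xi>\<close> that \<open>S\<close> puts there; outside the inclusions both weights are of order one
    (\<open>pinned_diagonal_bound\<close>). Summation over the nodes costs a factor \<open>card N\<close>, which is
    controlled by the degree and the diameter (\<open>card_le_degree_diam\<close>).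

  \<^item> Order one. The parallelogram inequality gives \<open>(A v, v) \<le> 4 (S v, v)\<close> for every \<open>v\<close>.

  The min-max principle (\<open>eigenvalue_le_by_subspace\<close>, \<open>eigenvalue_ge_by_kernel\<close>) is proved for
  any pair of symmetric forms on \<open>node_funs N\<close>, the second one positive definite. A maximal
  orthonormal system of eigenvectors is a basis, since minimizing the Rayleigh quotient on its
  orthogonal complement would extend it. Relative to such a basis \<open>B\<close> the entries of the eigenvalue
  list satisfying a predicate are counted by the basis vectors whose Rayleigh quotient satisfies
  it, and a count of dimensions finishes the proof.
\<close>


section \<open>Linear algebra of node functions\<close>

lemma sum_fun_apply: "(\<Sum>i\<in>I. f i) x = (\<Sum>i\<in>I. f i x)"
  for f :: "'i \<Rightarrow> 'a \<Rightarrow> real"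
  by (induction I rule: infinite_finite_induct) auto

definition delta :: "'a \<Rightarrow> 'a \<Rightarrow> real"
  where "delta z = (\<lambda>x. if x = z then 1 else 0)"

lemma inj_delta: "inj delta"
  by (rule injI) (metis delta_def zero_neq_one)

lemma subspace_node_funs: "subspace (node_funs N)"
  by (auto simp: subspace_def node_funs_def)

lemma delta_in_node_funs: "z \<in> N \<Longrightarrow> delta z \<in> node_funs N"
  by (auto simp: delta_def node_funs_def)

lemma node_fun_expansion:
  assumes "finite N" and "v \<in> node_funs N"
  shows "v = (\<Sum>z\<in>N. v z *\<^sub>R delta z)"
proof
  fix x
  show "v x = (\<Sum>z\<in>N. v z *\<^sub>R delta z) x"
    using assms by (auto simp: sum_fun_apply delta_def node_funs_def if_distrib cong: if_cong)
qed

lemma span_delta: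
  assumes "finite N"
  shows "span (delta ` N) = node_funs N"
proof
  show "span (delta ` N) \<subseteq> node_funs N"
    by (intro span_minimal subspace_node_funs) (auto intro: delta_in_node_funs)
  show "node_funs N \<subseteq> span (delta ` N)"
  proof
    fix v :: "'a \<Rightarrow> real" assume "v \<in> node_funs N"
    from node_fun_expansion[OF assms this] show "v \<in> span (delta ` N)"
      by (metis (no_types, lifting) image_eqI span_base span_scale span_sum)
  qed
qed

lemma independent_delta:
  assumes "finite N"
  shows "independent (delta ` N)"
proof (rule real_vector.independent_if_scalars_zero)
  show "finite (delta ` N)" using assms by simp
next
  fix k d assume sum: "(\<Sum>d\<in>delta ` N. k d *\<^sub>R d) = 0" and "d \<in> delta ` N"
  then obtain z where z: "z \<in> N" "d = delta z" by blast
  have "(\<Sum>y\<in>N. k (delta y) *\<^sub>R delta y) = 0"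
    using sum by (simp add: sum.reindex inj_on_subset[OF inj_delta])
  then have "(\<Sum>y\<in>N. k (delta y) *\<^sub>R delta y) z = 0" by simp
  then show "k d = 0"
    using z assms by (simp add: sum_fun_apply delta_def if_distrib cong: if_cong)
qed

lemma card_delta: "card (delta ` N) = card N"
  by (simp add: card_image inj_on_subset[OF inj_delta])

text \<open>
  The joint map of the functionals into the functions on \<open>J\<close> cannot be injective on the span of \<open>C\<close>,
  as it would carry \<open>C\<close> to an independent set larger than the spanning set \<open>delta ` J\<close>. Both
  halves of the min-max principle reduce to this statement.
\<close>

lemma common_kernel:
  fixes C :: "'b::real_vector set" and f :: "'j \<Rightarrow> 'b \<Rightarrow> real"
  assumes C: "independent C" and J: "finite J" "card J < card C"
    and lin: "\<And>j. j \<in> J \<Longrightarrow> linear (f j)"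
  obtains v where "v \<in> span C" and "v \<noteq> 0" and "\<forall>j\<in>J. f j v = 0"
proof -
  define \<Phi> where "\<Phi> v = (\<lambda>j. if j \<in> J then f j v else 0)" for v
  have lin\<Phi>: "linear \<Phi>"
    by (rule linearI) (auto simp: \<Phi>_def fun_eq_iff linear_add[OF lin] linear_scale[OF lin])
  have "\<not> inj_on \<Phi> (span C)"
  proof
    assume inj: "inj_on \<Phi> (span C)"
    have "independent (\<Phi> ` C)"
      by (rule linear_independent_injective_image[OF lin\<Phi> C inj])
    moreover have "\<Phi> ` C \<subseteq> span (delta ` J)"
      unfolding span_delta[OF J(1)] by (auto simp: node_funs_def \<Phi>_def)
    ultimately have "card (\<Phi> ` C) \<le> card (delta ` J)"
      using real_vector.independent_span_bound J(1) by blast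
    moreover have "card (\<Phi> ` C) = card C"
      using inj by (meson card_image inj_on_subset span_superset)
    ultimately show False using J(2) by (simp add: card_delta)
  qed
  then obtain v where v: "v \<in> span C" "\<Phi> v = 0" "v \<noteq> 0"
    using linear_injective_on_subspace_0[OF lin\<Phi> subspace_span] by blast
  have "f j v = 0" if "j \<in> J" for j
    using fun_cong[OF v(2), of j] that by (simp add: \<Phi>_def)
  with v show thesis by (intro that) auto
qed

text \<open>
  An instance of Tychonov's theorem for the product topology on functions: the box is a product of
  compact intervals and singletons.
\<close>

lemma compact_node_box:
  "compact {v \<in> node_funs N. \<forall>x\<in>N. \<bar>v x\<bar> \<le> 1}"
proof -
  define I where "I x = (if x \<in> N then {-1..1::real} else {0})" for x :: 'a
  have "compactin (product_topology (\<lambda>_. euclidean) UNIV) (PiE UNIV I)"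
    unfolding compactin_PiE by (auto simp: I_def)
  moreover have "PiE UNIV I = {v \<in> node_funs N. \<forall>x\<in>N. \<bar>v x\<bar> \<le> 1}"
    by (auto simp: I_def PiE_iff node_funs_def abs_le_iff split: if_splits)
  ultimately show ?thesis by (simp add: euclidean_product_topology)
qed


section \<open>Sorted lists with prescribed multiplicities\<close>

lemma sorted_concat_replicate:
  "sorted ts \<Longrightarrow> sorted (concat (map (\<lambda>t. replicate (k t) t) ts))"
  for ts :: "real list"
  by (induction ts) (auto simp: sorted_append)

lemma length_filter_concat_replicate:
  "distinct ts \<Longrightarrow> length (filter P (concat (map (\<lambda>t. replicate (k t) t) ts)))
    = (\<Sum>t\<in>{t \<in> set ts. P t}. k t)"
proof (induction ts)
  case (Cons t ts)
  have "{u \<in> set (t # ts). P u} = (if P t then insert t {u \<in> set ts. P u} else {u \<in> set ts. P u})"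
    by auto
  then show ?case using Cons by simp
qed simp

lemma sorted_nth_less_count:
  fixes c :: "'b::linorder"
  assumes "sorted ls" "i < length ls" "ls ! i < c"
  shows "i < length (filter (\<lambda>t. t < c) ls)"
proof -
  have "{..i} \<subseteq> {j. j < length ls \<and> ls ! j < c}"
    using assms by (auto intro: le_less_trans[OF sorted_nth_mono])
  then have "card {..i} \<le> card {j. j < length ls \<and> ls ! j < c}" by (intro card_mono) auto
  then show ?thesis by (simp add: length_filter_conv_card)
qed

lemma sorted_less_nth_count:
  fixes c :: "'b::linorder"
  assumes "sorted ls" "i < length ls" "c < ls ! i"
  shows "length (filter (\<lambda>t. t \<le> c) ls) \<le> i"
proof -
  have "j < i" if "j < length ls" "ls ! j \<le> c" for j
    using assms that sorted_nth_mono[of ls i j] by (meson leD leI le_less_trans)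
  then have "{j. j < length ls \<and> ls ! j \<le> c} \<subseteq> {..<i}" by auto
  then have "card {j. j < length ls \<and> ls ! j \<le> c} \<le> card {..<i}" by (intro card_mono) auto
  then show ?thesis by (simp add: length_filter_conv_card)
qed


section \<open>Simultaneous diagonalization of two forms\<close>

locale form_pair =
  fixes N :: "'a set" and a s :: "('a \<Rightarrow> real) \<Rightarrow> ('a \<Rightarrow> real) \<Rightarrow> real"
  assumes finite_N: "finite N"
    and lin_a: "linear (a v)" and lin_s: "linear (s v)"
    and sym_a: "a v w = a w v" and sym_s: "s v w = s w v"
    and pos_s: "v \<in> node_funs N \<Longrightarrow> v \<noteq> 0 \<Longrightarrow> 0 < s v v"
begin

lemma lin_a_left: "linear (\<lambda>v. a v w)" and lin_s_left: "linear (\<lambda>v. s v w)"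
  using lin_a[of w] lin_s[of w] by (simp_all only: sym_a[of _ w] sym_s[of _ w])

text \<open>
  An \<open>s\<close>-orthonormal set of eigenvectors. No separate eigenvalues are recorded: since \<open>s b b = 1\<close>,
  the eigenvalue of \<open>b\<close> can only be \<open>a b b\<close>.
\<close>

definition eigensystem :: "('a \<Rightarrow> real) set \<Rightarrow> bool"
  where "eigensystem B \<longleftrightarrow> finite B \<and> B \<subseteq> node_funs N \<and>
    (\<forall>b\<in>B. \<forall>c\<in>B. s b c = (if b = c then 1 else 0)) \<and>
    (\<forall>b\<in>B. \<forall>w\<in>node_funs N. a b w = a b b * s b w)"

lemma s_eigensystem_sum:
  assumes "eigensystem B" "b \<in> B"
  shows "s b (\<Sum>c\<in>B. k c *\<^sub>R c) = k b"
proof -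
  have "s b (\<Sum>c\<in>B. k c *\<^sub>R c) = (\<Sum>c\<in>B. k c * (if b = c then 1 else 0))"
    using assms unfolding eigensystem_def
    by (simp add: linear_sum[OF lin_s] linear_scale[OF lin_s])
  also have "\<dots> = k b"
    using assms by (simp add: eigensystem_def if_distrib cong: if_cong)
  finally show ?thesis .
qed

lemma independent_eigensystem:
  assumes "eigensystem B"
  shows "independent B"
proof (rule real_vector.independent_if_scalars_zero)
  show "finite B" using assms by (simp add: eigensystem_def)
  fix k b assume "(\<Sum>c\<in>B. k c *\<^sub>R c) = 0" "b \<in> B"
  then show "k b = 0" using s_eigensystem_sum[OF assms, of b k] by (simp add: linear_0[OF lin_s])
qed

lemma card_eigensystem_le:
  assumes "eigensystem B"
  shows "card B \<le> card N"
proof -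
  have "card B \<le> card (delta ` N)"
    using real_vector.independent_span_bound[of "delta ` N" B] independent_eigensystem[OF assms] assms finite_N
    by (simp add: span_delta eigensystem_def)
  then show ?thesis by (simp add: card_delta)
qed

lemma continuous_on_form:
  fixes f :: "('a \<Rightarrow> real) \<Rightarrow> ('a \<Rightarrow> real) \<Rightarrow> real"
  assumes "\<And>v. linear (f v)" and "\<And>v w. f v w = f w v"
  shows "continuous_on (node_funs N) (\<lambda>v. f v v)"
proof -
  have "continuous_on (node_funs N) (\<lambda>v. \<Sum>x\<in>N. v x * (\<Sum>y\<in>N. v y * f (delta x) (delta y)))"
    by (intro continuous_intros continuous_on_subset[OF continuous_on_product_coordinates]) auto
  moreover have "(\<Sum>x\<in>N. v x * (\<Sum>y\<in>N. v y * f (delta x) (delta y))) = f v v"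
    if "v \<in> node_funs N" for v
  proof -
    have ex: "f u v = (\<Sum>z\<in>N. v z * f u (delta z))" for u
      by (subst node_fun_expansion[OF finite_N that])
        (simp add: linear_sum[OF assms(1)] linear_scale[OF assms(1)])
    show ?thesis
      by (simp add: ex[of v] assms(2)[of v] ex)
  qed
  ultimately show ?thesis by (simp cong: continuous_on_cong)
qed

lemma continuous_on_functional:
  assumes "linear (f :: ('a \<Rightarrow> real) \<Rightarrow> real)"
  shows "continuous_on (node_funs N) f"
proof -
  have "continuous_on (node_funs N) (\<lambda>v. \<Sum>x\<in>N. v x * f (delta x))"
    by (intro continuous_intros continuous_on_subset[OF continuous_on_product_coordinates]) auto
  moreover have "(\<Sum>x\<in>N. v x * f (delta x)) = f v" if "v \<in> node_funs N" for v
    using arg_cong[OF node_fun_expansion[OF finite_N that], of f]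
    by (simp add: linear_sum[OF assms(1)] linear_scale[OF assms(1)])
  ultimately show ?thesis by (simp cong: continuous_on_cong)
qed

text \<open>
  The minimum is taken over the Euclidean unit sphere of the \<open>s\<close>-orthogonal complement of \<open>B\<close>. The
  Euclidean sphere, unlike the unit sphere of \<open>s\<close>, is visibly contained in a compact box;
  homogeneity of the quotient makes the choice of sphere immaterial.
\<close>

lemma rayleigh_minimizer:
  assumes v0: "v0 \<in> node_funs N" "v0 \<noteq> 0" "\<forall>b\<in>B. s b v0 = 0"
  obtains v t where "v \<in> node_funs N" "v \<noteq> 0" "\<forall>b\<in>B. s b v = 0" "a v v = t * s v v"
    and "\<And>w. w \<in> node_funs N \<Longrightarrow> \<forall>b\<in>B. s b w = 0 \<Longrightarrow> t * s w w \<le> a w w"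
proof -
  define Q where "Q v = (\<Sum>x\<in>N. v x * v x)" for v :: "'a \<Rightarrow> real"
  define X where "X = {v \<in> node_funs N. \<forall>x\<in>N. \<bar>v x\<bar> \<le> 1}"
  define K where "K = {v \<in> node_funs N. Q v = 1 \<and> (\<forall>b\<in>B. s b v = 0)}"
  have Q_pos: "0 < Q v" if v: "v \<in> node_funs N" "v \<noteq> 0" for v
  proof -
    obtain x where "v x \<noteq> 0" using v by (auto simp: fun_eq_iff)
    then show ?thesis
      unfolding Q_def using v finite_N
      by (intro sum_pos2[of N x]) (auto simp: node_funs_def zero_less_mult_iff)
  qed
  have KX: "K \<subseteq> X"
  proof
    fix v assume v: "v \<in> K"
    have "\<bar>v x\<bar> \<le> 1" if "x \<in> N" for x
    proof -
      have "v x * v x \<le> Q v"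
        unfolding Q_def using that finite_N by (intro member_le_sum) auto
      then have "(v x)\<^sup>2 \<le> 1" using v by (simp add: K_def power2_eq_square)
      then show ?thesis by (simp add: abs_square_le_1)
    qed
    then show "v \<in> X" using v by (simp add: K_def X_def)
  qed
  have compX: "compact X" unfolding X_def by (rule compact_node_box)
  have XV: "X \<subseteq> node_funs N" by (auto simp: X_def)
  have "closedin (top_of_set X) (X \<inter> Q -` {1} \<inter> (\<Inter>b\<in>B. X \<inter> s b -` {0}))"
  proof -
    have cQ: "continuous_on X Q"
      unfolding Q_def by (intro continuous_intros continuous_on_subset[OF continuous_on_product_coordinates]) auto
    have cs: "continuous_on X (s b)" for b
      using continuous_on_subset[OF continuous_on_functional[OF lin_s] XV] .
    have 1: "closedin (top_of_set X) (X \<inter> Q -` {1})"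
      by (rule continuous_closedin_preimage[OF cQ]) simp
    show ?thesis
    proof (cases "B = {}")
      case True then show ?thesis using 1 by simp
    next
      case False
      have "closedin (top_of_set X) (\<Inter>b\<in>B. X \<inter> s b -` {0})"
        using False by (intro closedin_INT continuous_closedin_preimage[OF cs]) auto
      with 1 show ?thesis by (rule closedin_Int)
    qed
  qed
  moreover have "X \<inter> Q -` {1} \<inter> (\<Inter>b\<in>B. X \<inter> s b -` {0}) = K"
    using KX XV by (auto simp: K_def)
  ultimately have compK: "compact K"
    using compX closedin_compact by metis
  have norm_in_K: "(1 / sqrt (Q w)) *\<^sub>R w \<in> K"
    if "w \<in> node_funs N" "w \<noteq> 0" "\<forall>b\<in>B. s b w = 0" for w
  proof -
    have "Q ((1 / sqrt (Q w)) *\<^sub>R w) = (\<Sum>x\<in>N. (1 / Q w) * (w x * w x))"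
      using Q_pos[OF that(1,2)] by (simp add: Q_def mult_ac)
    also have "\<dots> = 1"
      using Q_pos[OF that(1,2)] by (simp add: Q_def flip: sum_divide_distrib)
    finally show ?thesis using that
      by (auto simp: K_def linear_scale[OF lin_s] intro: subspace_scale[OF subspace_node_funs])
  qed
  have K_nz: "v \<noteq> 0" if "v \<in> K" for v
    using that by (auto simp: K_def Q_def)
  have KV: "K \<subseteq> node_funs N" by (auto simp: K_def)
  have cont: "continuous_on K (\<lambda>v. a v v / s v v)"
  proof (rule continuous_on_divide)
    show "continuous_on K (\<lambda>v. a v v)"
      by (rule continuous_on_subset[OF continuous_on_form[OF lin_a sym_a] KV])
    show "continuous_on K (\<lambda>v. s v v)"
      by (rule continuous_on_subset[OF continuous_on_form[OF lin_s sym_s] KV])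
    show "\<forall>v\<in>K. s v v \<noteq> 0"
    proof
      fix v assume "v \<in> K"
      then have "0 < s v v" using K_nz KV by (intro pos_s) auto
      then show "s v v \<noteq> 0" by simp
    qed
  qed
  have "K \<noteq> {}" using norm_in_K[OF v0] by blast
  then obtain v where v: "v \<in> K" and min: "\<forall>w\<in>K. a v v / s v v \<le> a w w / s w w"
    using continuous_attains_inf[OF compK _ cont] by blast
  define t where "t = a v v / s v v"
  have sv: "0 < s v v" using v KV K_nz by (intro pos_s) auto
  show thesis
  proof (rule that[of v t])
    show "v \<in> node_funs N" "v \<noteq> 0" "\<forall>b\<in>B. s b v = 0"
      using v K_nz by (auto simp: K_def)
    show "a v v = t * s v v" using sv by (simp add: t_def)
  next
    fix w assume w: "w \<in> node_funs N" "\<forall>b\<in>B. s b w = 0"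
    show "t * s w w \<le> a w w"
    proof (cases "w = 0")
      case True then show ?thesis by (simp add: linear_0[OF lin_s] linear_0[OF lin_a])
    next
      case False
      define r where "r = 1 / sqrt (Q w)"
      have r: "r \<noteq> 0" using Q_pos[OF w(1) False] by (simp add: r_def)
      have "a (r *\<^sub>R w) (r *\<^sub>R w) / s (r *\<^sub>R w) (r *\<^sub>R w) = a w w / s w w"
        using r by (simp add: linear_scale[OF lin_s] linear_scale[OF lin_a] sym_a[of "r *\<^sub>R w"] sym_s[of "r *\<^sub>R w"])
      then have "t \<le> a w w / s w w"
        using min norm_in_K[OF w(1) False w(2)] unfolding t_def r_def by metis
      then show ?thesis using pos_s[OF w(1) False] by (simp add: pos_le_divide_eq)
    qed
  qed
qed

lemma eigensystem_residual:
  assumes "eigensystem B" "w \<in> node_funs N"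
  shows "w - (\<Sum>b\<in>B. s b w *\<^sub>R b) \<in> node_funs N"
    and "b \<in> B \<Longrightarrow> s b (w - (\<Sum>c\<in>B. s c w *\<^sub>R c)) = 0"
proof -
  have "(\<Sum>b\<in>B. s b w *\<^sub>R b) \<in> node_funs N"
    using assms by (intro subspace_sum subspace_scale subspace_node_funs) (auto simp: eigensystem_def)
  then show "w - (\<Sum>b\<in>B. s b w *\<^sub>R b) \<in> node_funs N"
    using assms(2) by (rule subspace_diff[OF subspace_node_funs, rotated])
  show "s b (w - (\<Sum>c\<in>B. s c w *\<^sub>R c)) = 0" if "b \<in> B"
    by (simp add: linear_diff[OF lin_s] s_eigensystem_sum[OF assms(1) that])
qed

text \<open>
  With \<open>t\<close> the minimum and \<open>u\<close> a minimizer, the form \<open>q = a - t s\<close> is nonnegative on the complement of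
  \<open>B\<close> and vanishes at \<open>u\<close>; a nonnegative form has \<open>q u w = 0\<close> for all \<open>w\<close> as soon as \<open>q u u = 0\<close>. Hence
  \<open>u\<close> satisfies the eigenvalue equation against the complement, and against \<open>B\<close> it holds because
  \<open>B\<close> consists of eigenvectors orthogonal to \<open>u\<close>.
\<close>

lemma eigensystem_extend:
  assumes B: "eigensystem B"
    and v0: "v0 \<in> node_funs N" "v0 \<noteq> 0" "\<forall>b\<in>B. s b v0 = 0"
  obtains v where "v \<notin> B" and "eigensystem (insert v B)"
proof -
  obtain u t where u: "u \<in> node_funs N" "u \<noteq> 0" "\<forall>b\<in>B. s b u = 0" and ut: "a u u = t * s u u"
    and min: "\<And>w. w \<in> node_funs N \<Longrightarrow> \<forall>b\<in>B. s b w = 0 \<Longrightarrow> t * s w w \<le> a w w"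
    using rayleigh_minimizer[OF v0] by metis
  define q where "q v w = a v w - t * s v w" for v w
  have lin_q: "linear (q v)" for v
    unfolding q_def by (rule linearI)
      (simp_all add: linear_add[OF lin_a] linear_add[OF lin_s] linear_scale[OF lin_a]
        linear_scale[OF lin_s] algebra_simps)
  have sym_q: "q v w = q w v" for v w
    by (simp add: q_def sym_a[of v] sym_s[of v])
  have q_orth: "q u w = 0" if w: "w \<in> node_funs N" "\<forall>b\<in>B. s b w = 0" for w
  proof (rule ccontr)
    assume nz: "q u w \<noteq> 0"
    \<comment> \<open>the value at which the affine function \<open>q w w + 2 r q u w\<close> of \<open>r\<close> equals \<open>-1\<close>\<close>
    define r where "r = - (q w w + 1) / (2 * q u w)"
    have "w + r *\<^sub>R u \<in> node_funs N"
      using w u by (intro subspace_add subspace_scale subspace_node_funs)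
    moreover have "\<forall>b\<in>B. s b (w + r *\<^sub>R u) = 0"
      using w u by (simp add: linear_add[OF lin_s] linear_scale[OF lin_s])
    ultimately have "0 \<le> q (w + r *\<^sub>R u) (w + r *\<^sub>R u)"
      using min by (simp add: q_def)
    also have "\<dots> = q w w + 2 * r * q u w"
      using ut by (simp add: linear_add[OF lin_q] linear_scale[OF lin_q] sym_q[of "w + r *\<^sub>R u"]
          sym_q[of w u]) (simp add: q_def)
    also have "\<dots> = -1" using nz by (simp add: r_def field_simps)
    finally show False by simp
  qed
  have q_basis: "q u b = 0" if "b \<in> B" for b
  proof -
    have "a u b = a b b * s b u" using B u that unfolding eigensystem_def by (metis sym_a)
    then show ?thesis using u that by (simp add: q_def sym_s[of u])
  qed
  have q_zero: "q u w = 0" if w: "w \<in> node_funs N" for w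
  proof -
    have "q u (w - (\<Sum>b\<in>B. s b w *\<^sub>R b)) = 0"
      using eigensystem_residual[OF B w] by (intro q_orth) auto
    then show ?thesis
      by (simp add: linear_diff[OF lin_q] linear_sum[OF lin_q] linear_scale[OF lin_q] q_basis)
  qed
  define k where "k = 1 / sqrt (s u u)"
  define v where "v = k *\<^sub>R u"
  have su: "0 < s u u" using pos_s u by blast
  have vv: "s v v = 1"
    using su by (simp add: v_def k_def linear_scale[OF lin_s] sym_s[of "_ *\<^sub>R u"])
  have vB: "s b v = 0" if "b \<in> B" for b
    using u that by (simp add: v_def linear_scale[OF lin_s])
  have "v \<notin> B" using vv vB by force
  moreover have "eigensystem (insert v B)"
  proof -
    have vN: "v \<in> node_funs N" unfolding v_def using u by (intro subspace_scale subspace_node_funs)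
    have eig: "a v w = t * s v w" if "w \<in> node_funs N" for w
      using q_zero[OF that]
      by (simp add: q_def v_def linear_scale[OF lin_s] linear_scale[OF lin_a] sym_a[of "k *\<^sub>R u"]
          sym_s[of "k *\<^sub>R u"] sym_a[of w] sym_s[of w])
    have eig': "a v w = a v v * s v w" if "w \<in> node_funs N" for w
      using eig[OF vN] eig[OF that] vv by simp
    have orth: "s b c = (if b = c then 1 else 0)" if bc: "b \<in> insert v B" "c \<in> insert v B" for b c
    proof -
      consider "b = v" "c = v" | "b = v" "c \<in> B" "c \<noteq> v" | "b \<in> B" "c = v" "b \<noteq> v"
        | "b \<in> B" "c \<in> B"
        using bc \<open>v \<notin> B\<close> by blast
      then show ?thesis
      proof cases
        case 2 then show ?thesis using vB[of c] sym_s[of v c] by simp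
      next
        case 4 then show ?thesis using B unfolding eigensystem_def by blast
      qed (use vv vB in simp_all)
    qed
    show ?thesis
      unfolding eigensystem_def
    proof (intro conjI ballI)
      fix b w assume "b \<in> insert v B" "w \<in> node_funs N"
      then show "a b w = a b b * s b w"
        using eig' B unfolding eigensystem_def by blast
    qed (use B vN orth in \<open>auto simp: eigensystem_def\<close>)
  qed
  ultimately show thesis by (rule that)
qed

definition eigenbasis :: "('a \<Rightarrow> real) set \<Rightarrow> bool"
  where "eigenbasis B \<longleftrightarrow> eigensystem B \<and> (\<forall>v\<in>node_funs N. v = (\<Sum>b\<in>B. s b v *\<^sub>R b))"

lemma eigenbasis_exists:
  obtains B where "eigenbasis B"
proof -
  have "eigensystem {}" by (simp add: eigensystem_def)
  then obtain B where B: "eigensystem B" and max: "\<And>B'. eigensystem B' \<Longrightarrow> card B' \<le> card B"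
    using ex_has_greatest_nat[of eigensystem "{}" card "Suc (card N)"] card_eigensystem_le
    by (auto simp: less_Suc_eq_le)
  have "eigenbasis B"
    unfolding eigenbasis_def
  proof (intro conjI ballI B)
    fix v assume v: "v \<in> node_funs N"
    show "v = (\<Sum>b\<in>B. s b v *\<^sub>R b)"
    proof (rule ccontr)
      assume "v \<noteq> (\<Sum>b\<in>B. s b v *\<^sub>R b)"
      then have nz: "v - (\<Sum>b\<in>B. s b v *\<^sub>R b) \<noteq> 0" by simp
      have orth: "\<forall>b\<in>B. s b (v - (\<Sum>b\<in>B. s b v *\<^sub>R b)) = 0"
        using eigensystem_residual(2)[OF B v] by blast
      obtain u where u: "u \<notin> B" "eigensystem (insert u B)"
        by (rule eigensystem_extend[OF B eigensystem_residual(1)[OF B v] nz orth])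
      have "finite B" using B by (simp add: eigensystem_def)
      with max[OF u(2)] u(1) show False by simp
    qed
  qed
  then show thesis by (rule that)
qed


section \<open>Eigenvalues with multiplicity and their min-max bounds\<close>

abbreviation "eigenspace \<equiv> gen_eigenspace N (form_op N a) (form_op N s)"

abbreviation "eigenvalue_list \<equiv> gen_eigenvalue_list N (form_op N a) (form_op N s)"

abbreviation "eigenvalue \<equiv> gen_eigenvalue N (form_op N a) (form_op N s)"

lemma node_funs_eqI:
  assumes "u \<in> node_funs N" "v \<in> node_funs N" "\<And>w. w \<in> node_funs N \<Longrightarrow> ip N u w = ip N v w"
  shows "u = v"
proof
  fix x
  have ip_delta: "ip N w (delta x) = w x" if "x \<in> N" for w
    using that finite_N by (simp add: ip_def delta_def if_distrib cong: if_cong)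
  show "u x = v x"
  proof (cases "x \<in> N")
    case True
    then show ?thesis using assms(3)[OF delta_in_node_funs[OF True]] by (simp add: ip_delta)
  next
    case False
    then show ?thesis using assms(1,2) by (simp add: node_funs_def)
  qed
qed

text \<open>
  Passing from the operators to the forms: both sides of the eigenvalue equation lie in
  \<open>node_funs N\<close>, where the inner product is nondegenerate.
\<close>

lemma eigenspace_eq:
  "eigenspace t = {\<psi> \<in> node_funs N. \<forall>w\<in>node_funs N. a \<psi> w = t * s \<psi> w}"
proof -
  have "form_op N a \<psi> = t *\<^sub>R form_op N s \<psi> \<longleftrightarrow> (\<forall>w\<in>node_funs N. a \<psi> w = t * s \<psi> w)" for \<psi>
  proof
    have ip_scale: "ip N (t *\<^sub>R form_op N s \<psi>) w = t * s \<psi> w" if "w \<in> node_funs N" for w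
    proof -
      have "ip N (t *\<^sub>R form_op N s \<psi>) w = t * ip N (form_op N s \<psi>) w"
        by (simp add: ip_def sum_distrib_left mult.assoc)
      then show ?thesis by (simp only: form_op_ip[where a = s, OF finite_N lin_s that])
    qed
    {
      assume "form_op N a \<psi> = t *\<^sub>R form_op N s \<psi>"
      then show "\<forall>w\<in>node_funs N. a \<psi> w = t * s \<psi> w"
        using ip_scale form_op_ip[where a = a, OF finite_N lin_a] by metis
    next
      assume eq: "\<forall>w\<in>node_funs N. a \<psi> w = t * s \<psi> w"
      show "form_op N a \<psi> = t *\<^sub>R form_op N s \<psi>"
      proof (rule node_funs_eqI)
        show "form_op N a \<psi> \<in> node_funs N"
          by (rule form_op_in[where a = a, OF finite_N lin_a])
        show "t *\<^sub>R form_op N s \<psi> \<in> node_funs N"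
          by (intro subspace_scale subspace_node_funs form_op_in[where a = s, OF finite_N lin_s])
        show "ip N (form_op N a \<psi>) w = ip N (t *\<^sub>R form_op N s \<psi>) w"
          if w: "w \<in> node_funs N" for w
          using eq w by (simp only: ip_scale[OF w] form_op_ip[where a = a, OF finite_N lin_a w])
      qed
    }
  qed
  then show ?thesis by (simp add: gen_eigenspace_def)
qed

context
  fixes B
  assumes B: "eigenbasis B"
begin

lemma eigensystem_B: "eigensystem B" and finite_B: "finite B" and B_node_funs: "B \<subseteq> node_funs N"
  using B by (auto simp: eigenbasis_def eigensystem_def)

lemma B_expansion: "v \<in> node_funs N \<Longrightarrow> v = (\<Sum>b\<in>B. s b v *\<^sub>R b)"
  using B by (simp add: eigenbasis_def)

lemma B_eig: "b \<in> B \<Longrightarrow> w \<in> node_funs N \<Longrightarrow> a b w = a b b * s b w"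
  using eigensystem_B unfolding eigensystem_def by blast

lemma B_orthonormal: "b \<in> B \<Longrightarrow> c \<in> B \<Longrightarrow> s b c = (if b = c then 1 else 0)"
  using eigensystem_B unfolding eigensystem_def by blast

lemma card_B: "card B = card N"
proof -
  have "span B = node_funs N"
  proof
    show "span B \<subseteq> node_funs N" by (rule span_minimal[OF B_node_funs subspace_node_funs])
    show "node_funs N \<subseteq> span B"
    proof
      fix v assume "v \<in> node_funs N"
      from B_expansion[OF this] show "v \<in> span B"
        by (metis (no_types, lifting) span_base span_scale span_sum)
    qed
  qed
  then have "dim (delta ` N) = dim B"
    using real_vector.dim_span[of B] real_vector.dim_span[of "delta ` N"] span_delta[OF finite_N]
    by simp
  then show ?thesis
    using real_vector.dim_eq_card_independent[OF independent_eigensystem[OF eigensystem_B]]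
      real_vector.dim_eq_card_independent[OF independent_delta[OF finite_N]]
    by (simp add: card_delta)
qed

lemma eigenspace_span: "eigenspace t = span {b \<in> B. a b b = t}"
proof
  show "span {b \<in> B. a b b = t} \<subseteq> eigenspace t"
  proof (rule span_minimal)
    show "{b \<in> B. a b b = t} \<subseteq> eigenspace t"
      using B_node_funs B_eig by (auto simp: eigenspace_eq)
    show "subspace (eigenspace t)"
      unfolding eigenspace_eq
      by (rule subspaceI)
        (simp_all add: subspace_0 subspace_add subspace_scale subspace_node_funs
          linear_0[OF lin_a_left] linear_0[OF lin_s_left] linear_add[OF lin_a_left]
          linear_add[OF lin_s_left] linear_scale[OF lin_a_left] linear_scale[OF lin_s_left]
          distrib_left)
  qed
  show "eigenspace t \<subseteq> span {b \<in> B. a b b = t}"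
  proof
    fix \<psi> assume \<psi>: "\<psi> \<in> eigenspace t"
    then have \<psi>N: "\<psi> \<in> node_funs N" by (simp add: eigenspace_eq)
    have "s b \<psi> *\<^sub>R b \<in> span {b \<in> B. a b b = t}" if b: "b \<in> B" for b
    proof (cases "a b b = t")
      case True
      then show ?thesis using b by (intro span_scale span_base) simp
    next
      case False
      have "a \<psi> b = t * s \<psi> b" using \<psi> b B_node_funs by (auto simp: eigenspace_eq)
      then have "a b b * s b \<psi> = t * s b \<psi>"
        using B_eig[OF b \<psi>N] sym_a[of \<psi> b] sym_s[of \<psi> b] by simp
      then have "s b \<psi> = 0" using False by simp
      then show ?thesis by (simp add: span_zero)
    qed
    then have "(\<Sum>b\<in>B. s b \<psi> *\<^sub>R b) \<in> span {b \<in> B. a b b = t}" by (rule span_sum)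
    then show "\<psi> \<in> span {b \<in> B. a b b = t}" using B_expansion[OF \<psi>N] by simp
  qed
qed

lemma dim_eigenspace: "dim (eigenspace t) = card {b \<in> B. a b b = t}"
proof -
  have "independent {b \<in> B. a b b = t}"
    using independent_eigensystem[OF eigensystem_B] by (rule real_vector.independent_mono) auto
  then show ?thesis
    using eigenspace_span real_vector.dim_eq_card_independent by simp
qed

lemma eigenvalues_eq: "gen_eigenvalues N (form_op N a) (form_op N s) = (\<lambda>b. a b b) ` B"
proof
  show "(\<lambda>b. a b b) ` B \<subseteq> gen_eigenvalues N (form_op N a) (form_op N s)"
  proof
    fix t assume "t \<in> (\<lambda>b. a b b) ` B"
    then obtain b where b: "b \<in> B" "t = a b b" by blast
    have "b \<noteq> 0" using B_orthonormal[OF b(1) b(1)] linear_0[OF lin_s, of b] by auto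
    moreover have "b \<in> eigenspace t"
      unfolding eigenspace_span using b by (intro span_base) simp
    ultimately show "t \<in> gen_eigenvalues N (form_op N a) (form_op N s)"
      by (auto simp: gen_eigenvalues_def)
  qed
  show "gen_eigenvalues N (form_op N a) (form_op N s) \<subseteq> (\<lambda>b. a b b) ` B"
  proof
    fix t assume "t \<in> gen_eigenvalues N (form_op N a) (form_op N s)"
    then obtain \<psi> where "\<psi> \<in> span {b \<in> B. a b b = t}" "\<psi> \<noteq> 0"
      by (auto simp: gen_eigenvalues_def eigenspace_span)
    then have "{b \<in> B. a b b = t} \<noteq> {}" by (metis span_empty singletonD)
    then show "t \<in> (\<lambda>b. a b b) ` B" by blast
  qed
qed

lemma sorted_eigenvalue_list: "sorted eigenvalue_list"
  unfolding gen_eigenvalue_list_def by (intro sorted_concat_replicate) simp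

text \<open>
  The dimension of an eigenspace is the number of vectors of \<open>B\<close> in it, so that the eigenvalue list
  enumerates the family \<open>a b b\<close> over \<open>b \<in> B\<close>. Stated by counting, this fact needs no ordering of \<open>B\<close>.
\<close>

lemma length_filter_eigenvalue_list:
  "length (filter P eigenvalue_list) = card {b \<in> B. P (a b b)}"
proof -
  have "length (filter P eigenvalue_list) = (\<Sum>t\<in>{t \<in> (\<lambda>b. a b b) ` B. P t}. card {b \<in> B. a b b = t})"
    using finite_B
    by (simp add: gen_eigenvalue_list_def length_filter_concat_replicate dim_eigenspace eigenvalues_eq)
  also have "\<dots> = card (\<Union>t\<in>{t \<in> (\<lambda>b. a b b) ` B. P t}. {b \<in> B. a b b = t})"
    using finite_B by (intro card_UN_disjoint[symmetric]) auto
  also have "(\<Union>t\<in>{t \<in> (\<lambda>b. a b b) ` B. P t}. {b \<in> B. a b b = t}) = {b \<in> B. P (a b b)}"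
    by auto
  finally show ?thesis .
qed

lemma length_eigenvalue_list: "length eigenvalue_list = card N"
  using length_filter_eigenvalue_list[of "\<lambda>_. True"] card_B by simp

lemma rayleigh_expansion:
  assumes "v \<in> node_funs N"
  shows "a v v - c * s v v = (\<Sum>b\<in>B. (a b b - c) * (s b v)\<^sup>2)"
proof -
  have expand: "f v v = (\<Sum>b\<in>B. s b v * f b v)"
    if lin: "\<And>u. linear (f u)" and sym: "\<And>u w. f u w = f w u"
    for f :: "('a \<Rightarrow> real) \<Rightarrow> ('a \<Rightarrow> real) \<Rightarrow> real"
  proof -
    have "f v v = f v (\<Sum>b\<in>B. s b v *\<^sub>R b)" using B_expansion[OF assms] by simp
    also have "\<dots> = (\<Sum>b\<in>B. s b v * f v b)" by (simp add: linear_sum[OF lin] linear_scale[OF lin])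
    also have "\<dots> = (\<Sum>b\<in>B. s b v * f b v)" by (intro sum.cong refl arg_cong[of _ _ "(*) _"] sym)
    finally show ?thesis .
  qed
  have s: "s v v = (\<Sum>b\<in>B. s b v * s b v)" by (rule expand[OF lin_s sym_s])
  have "a v v = (\<Sum>b\<in>B. s b v * a b v)" by (rule expand[OF lin_a sym_a])
  also have "\<dots> = (\<Sum>b\<in>B. s b v * (a b b * s b v))"
    using B_eig[OF _ assms] by (intro sum.cong) simp_all
  finally have "a v v - c * s v v
      = (\<Sum>b\<in>B. s b v * (a b b * s b v)) - c * (\<Sum>b\<in>B. s b v * s b v)"
    by (simp only: s)
  also have "\<dots> = (\<Sum>b\<in>B. s b v * (a b b * s b v) - c * (s b v * s b v))"
    by (simp only: sum_distrib_left sum_subtractf)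
  also have "\<dots> = (\<Sum>b\<in>B. (a b b - c) * (s b v)\<^sup>2)"
    by (intro sum.cong refl) (simp add: algebra_simps power2_eq_square)
  finally show ?thesis .
qed

lemma rayleigh_less:
  assumes v: "v \<in> node_funs N" "v \<noteq> 0" and c: "\<And>b. b \<in> B \<Longrightarrow> s b v \<noteq> 0 \<Longrightarrow> a b b < c"
  shows "a v v < c * s v v"
proof -
  have "\<exists>b\<in>B. s b v \<noteq> 0"
    using B_expansion[OF v(1)] v(2) by (metis (no_types, lifting) scale_zero_left sum.neutral)
  then obtain b where b: "b \<in> B" "s b v \<noteq> 0" by blast
  have "0 < (\<Sum>b\<in>B. (c - a b b) * (s b v)\<^sup>2)"
  proof (rule sum_pos2[OF finite_B b(1)])
    show "0 < (c - a b b) * (s b v)\<^sup>2" using b c[OF b] by simp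
    show "0 \<le> (c - a b b) * (s b v)\<^sup>2" if "b \<in> B" for b
      using c[OF that] by (cases "s b v = 0") auto
  qed
  also have "\<dots> = - (a v v - c * s v v)"
    by (simp add: rayleigh_expansion[OF v(1)] sum_negf[symmetric] algebra_simps)
  finally show ?thesis by simp
qed

lemma rayleigh_greater:
  assumes v: "v \<in> node_funs N" "v \<noteq> 0" and c: "\<And>b. b \<in> B \<Longrightarrow> s b v \<noteq> 0 \<Longrightarrow> c < a b b"
  shows "c * s v v < a v v"
proof -
  have "\<exists>b\<in>B. s b v \<noteq> 0"
    using B_expansion[OF v(1)] v(2) by (metis (no_types, lifting) scale_zero_left sum.neutral)
  then obtain b where b: "b \<in> B" "s b v \<noteq> 0" by blast
  have "0 < (\<Sum>b\<in>B. (a b b - c) * (s b v)\<^sup>2)"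
  proof (rule sum_pos2[OF finite_B b(1)])
    show "0 < (a b b - c) * (s b v)\<^sup>2" using b c[OF b] by simp
    show "0 \<le> (a b b - c) * (s b v)\<^sup>2" if "b \<in> B" for b
      using c[OF that] by (cases "s b v = 0") auto
  qed
  then show ?thesis by (simp add: rayleigh_expansion[OF v(1), symmetric])
qed

end

text \<open>
  If the \<open>m\<close>-th eigenvalue exceeded \<open>c\<close>, fewer than \<open>m\<close> basis vectors would have an eigenvalue at
  most \<open>c\<close>, so some nonzero \<open>v \<in> span C\<close> would be orthogonal to all of them. Such a \<open>v\<close> is a combination
  of eigenvectors with larger eigenvalues, and its Rayleigh quotient is above \<open>c\<close>.
\<close>

lemma eigenvalue_le_by_subspace:
  assumes C: "independent C" "C \<subseteq> node_funs N" and m: "card C = m" "1 \<le> m"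
    and c: "\<And>v. v \<in> span C \<Longrightarrow> a v v \<le> c * s v v"
  shows "eigenvalue m \<le> c"
proof (rule ccontr)
  assume "\<not> eigenvalue m \<le> c"
  then have gt: "c < eigenvalue_list ! (m - 1)" by (simp add: gen_eigenvalue_def)
  obtain B where B: "eigenbasis B" by (rule eigenbasis_exists)
  define J where "J = {b \<in> B. a b b \<le> c}"
  have "m \<le> card N"
    using real_vector.independent_span_bound[of "delta ` N" C] C m finite_N
    by (simp add: span_delta card_delta)
  then have "length (filter (\<lambda>t. t \<le> c) eigenvalue_list) \<le> m - 1"
    using gt m(2) length_eigenvalue_list[OF B]
    by (intro sorted_less_nth_count sorted_eigenvalue_list[OF B]) auto
  then have cardJ: "card J < card C"
    using m by (simp add: length_filter_eigenvalue_list[OF B] J_def)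
  have "finite J" using finite_B[OF B] by (simp add: J_def)
  then obtain v where v: "v \<in> span C" "v \<noteq> 0" and orth: "\<forall>b\<in>J. s b v = 0"
    by (rule common_kernel[where f = s, OF C(1) _ cardJ lin_s])
  have vN: "v \<in> node_funs N" using v(1) span_minimal[OF C(2) subspace_node_funs] by blast
  have "c * s v v < a v v"
    using orth by (intro rayleigh_greater[OF B vN v(2)]) (force simp: J_def)
  with c[OF v(1)] show False by simp
qed

text \<open>
  The dual bound, with the subspace given as the common kernel of fewer than \<open>m\<close> functionals: if the
  \<open>m\<close>-th eigenvalue were below \<open>c\<close>, at least \<open>m\<close> basis vectors would have eigenvalue below \<open>c\<close>, and
  their span would meet the kernel nontrivially.
\<close>

lemma eigenvalue_ge_by_kernel:
  fixes f :: "'j \<Rightarrow> ('a \<Rightarrow> real) \<Rightarrow> real"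
  assumes J: "finite J" "card J < m" and m: "m \<le> card N"
    and lin: "\<And>j. j \<in> J \<Longrightarrow> linear (f j)"
    and c: "\<And>v. v \<in> node_funs N \<Longrightarrow> \<forall>j\<in>J. f j v = 0 \<Longrightarrow> c * s v v \<le> a v v"
  shows "c \<le> eigenvalue m"
proof (rule ccontr)
  assume "\<not> c \<le> eigenvalue m"
  then have less: "eigenvalue_list ! (m - 1) < c" by (simp add: gen_eigenvalue_def)
  obtain B where B: "eigenbasis B" by (rule eigenbasis_exists)
  define C where "C = {b \<in> B. a b b < c}"
  have "m - 1 < length (filter (\<lambda>t. t < c) eigenvalue_list)"
    using less J m length_eigenvalue_list[OF B]
    by (intro sorted_nth_less_count sorted_eigenvalue_list[OF B]) auto
  then have cardC: "card J < card C"
    using J by (simp add: length_filter_eigenvalue_list[OF B] C_def)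
  have indep: "independent C"
    using independent_eigensystem[OF eigensystem_B[OF B]]
    by (rule real_vector.independent_mono) (auto simp: C_def)
  obtain v where v: "v \<in> span C" "v \<noteq> 0" and ker: "\<forall>j\<in>J. f j v = 0"
    by (rule common_kernel[OF indep J(1) cardC lin])
  have "C \<subseteq> node_funs N" using B_node_funs[OF B] by (auto simp: C_def)
  then have vN: "v \<in> node_funs N" using v(1) span_minimal[OF _ subspace_node_funs] by blast
  have "s b v = 0" if b: "b \<in> B" "b \<notin> C" for b
  proof -
    have "C \<subseteq> {w. s b w = 0}" using b B_orthonormal[OF B] by (auto simp: C_def)
    moreover have "subspace {w. s b w = 0}"
      by (rule linear_subspace_kernel[OF lin_s])
    ultimately show ?thesis using v(1) span_minimal by blast
  qed
  then have "a v v < c * s v v"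
    by (intro rayleigh_less[OF B vN v(2)]) (force simp: C_def)
  with c[OF vN] ker show False by force
qed

end


section \<open>Paths and balls in graphs\<close>

lemma connected_edge_at:
  assumes "graph_connected E P" and "{p, q} \<subseteq> P" "p \<noteq> q" and "x \<in> P"
  shows "\<exists>y\<in>P. {x, y} \<in> E"
proof -
  obtain z where z: "z \<in> P" "z \<noteq> x" using assms(2,3) by (metis insert_subset)
  have "(x, z) \<in> (adj E P)\<^sup>*" using assms z by (auto simp: graph_connected_def)
  then show ?thesis using z(2) by (cases rule: converse_rtranclE) (auto simp: adj_def)
qed

lemma relpow_graph_diam:
  assumes "finite P" "graph_connected E P" "graph_diam E P \<le> d" "x \<in> P" "y \<in> P"
  shows "\<exists>k\<le>d. (x, y) \<in> adj E P ^^ k"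
proof -
  have "\<exists>k. (x, y) \<in> adj E P ^^ k"
    using assms by (auto simp: graph_connected_def rtrancl_is_UN_relpow)
  then have "(x, y) \<in> adj E P ^^ graph_dist E P x y"
    unfolding graph_dist_def by (rule LeastI_ex)
  moreover have "graph_dist E P x y \<le> graph_diam E P"
    unfolding graph_diam_def using assms by (intro Max_ge) auto
  ultimately show ?thesis using assms(3) le_trans by blast
qed

text \<open>
  Bounding the largest difference across an edge, instead of summing squares along the path,
  gives the Poincare-type estimates below without the Cauchy-Schwarz inequality.
\<close>

lemma relpow_variation:
  fixes v :: "'a \<Rightarrow> real"
  assumes step: "\<And>y z. (y, z) \<in> adj E P \<Longrightarrow> \<bar>v y - v z\<bar> \<le> \<delta>"
  shows "(x, y) \<in> adj E P ^^ k \<Longrightarrow> \<bar>v x - v y\<bar> \<le> real k * \<delta>"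
proof (induction k arbitrary: y)
  case (Suc k)
  then obtain z where "(x, z) \<in> adj E P ^^ k" "(z, y) \<in> adj E P" by auto
  then have "\<bar>v x - v z\<bar> \<le> real k * \<delta>" "\<bar>v z - v y\<bar> \<le> \<delta>" using Suc.IH step by auto
  then show ?case by (simp add: algebra_simps)
qed simp

lemma card_le_degree_diam:
  assumes "finite N" and nbrs: "\<And>x. x \<in> N \<Longrightarrow> finite (nbrs E x) \<and> card (nbrs E x) \<le> c"
    and conn: "graph_connected E N" and diam: "graph_diam E N \<le> d"
  shows "card N \<le> (\<Sum>k\<le>d. c ^ k)"
proof -
  obtain x where x: "x \<in> N" using conn by (auto simp: graph_connected_def)
  define B where "B k = {y. (x, y) \<in> adj E N ^^ k}" for k
  have BN: "B k \<subseteq> N" for k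
    using x by (cases k) (auto simp: B_def adj_def)
  have "card (B k) \<le> c ^ k" for k
  proof (induction k)
    case 0
    have "B 0 = {x}" by (auto simp: B_def)
    then show ?case by simp
  next
    case (Suc k)
    have "B (Suc k) \<subseteq> (\<Union>y\<in>B k. nbrs E y)"
      by (auto simp: B_def adj_def nbrs_def)
    moreover have fin: "finite (B k)" using BN \<open>finite N\<close> by (rule finite_subset)
    ultimately have "card (B (Suc k)) \<le> card (\<Union>y\<in>B k. nbrs E y)"
      using BN nbrs by (intro card_mono finite_UN_I) auto
    also have "\<dots> \<le> (\<Sum>y\<in>B k. card (nbrs E y))" by (rule card_UN_le[OF fin])
    also have "\<dots> \<le> (\<Sum>y\<in>B k. c)" using BN nbrs by (intro sum_mono) auto
    also have "\<dots> \<le> c ^ Suc k" using Suc by simp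
    finally show ?case .
  qed
  then have sum: "(\<Sum>k\<le>d. card (B k)) \<le> (\<Sum>k\<le>d. c ^ k)" by (intro sum_mono)
  have "N \<subseteq> (\<Union>k\<le>d. B k)"
    using relpow_graph_diam[OF \<open>finite N\<close> conn diam x] by (auto simp: B_def)
  then have "card N \<le> card (\<Union>k\<le>d. B k)"
    using finite_subset[OF BN \<open>finite N\<close>] by (intro card_mono) auto
  also have "\<dots> \<le> (\<Sum>k\<le>d. card (B k))" by (rule card_UN_le) simp
  finally show ?thesis using sum by simp
qed


section \<open>The energy of a high-contrast network\<close>

locale contrast_regime = high_contrast_network +
  assumes CLinf_pos: "0 < CLinf" and CLinf_le: "CLinf \<le> CLsup"
    and xi_ge_1: "1 \<le> \<xi>" and Ct_pos: "0 < Ct"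
begin

lemma edge_nodes: "{x, y} \<in> E \<Longrightarrow> x \<in> N \<and> y \<in> N \<and> x \<noteq> y"
  using edges by (fastforce simp: doubleton_eq_iff)

lemma nbrs_eq: "nbrs E x = {y. y \<in> N \<and> {x, y} \<in> E}"
  using edge_nodes by (auto simp: nbrs_def)

lemma finite_nbrs: "finite (nbrs E x)"
  using finite_nodes by (simp add: nbrs_eq)

lemma inclusion_subset: "i \<in> {1..Nch} \<Longrightarrow> R i \<subseteq> N"
  using decomposition(1) by blast

text \<open>
  The dichotomy behind the contrast: distinct inclusions are not joined by an edge, so an edge of
  weight of order \<open>\<xi>\<close> has both ends in the same inclusion.
\<close>

lemma edge_cases [consumes 1, case_names plain high]:
  assumes "{x, y} \<in> E"
  obtains (plain) "L x y = 1" "x \<in> R1 \<or> y \<in> R1"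
  | (high) i where "i \<in> {1..Nch}" "x \<in> R i" "y \<in> R i" "CLinf * \<xi> \<le> L x y" "L x y \<le> CLsup * \<xi>"
proof (cases "x \<in> R1 \<or> y \<in> R1")
  case True
  have "L x y = 1"
    using True weights_R1[of x y] weights_R1[of y x] weights_sym[of x y] assms
    by (auto simp: insert_commute)
  then show thesis using True by (rule plain)
next
  case False
  then obtain i j where i: "i \<in> {1..Nch}" "x \<in> R i" and j: "j \<in> {1..Nch}" "y \<in> R j"
    using edge_nodes[OF assms] decomposition(1) by blast
  have "i = j" using disconnected_inclusions[OF i(1) j(1) _ i(2) j(2)] assms by blast
  then show thesis using high[of i] weights_high[OF assms] i j by blast
qed

lemma weight_bounds:
  assumes "{x, y} \<in> E"
  shows "min 1 CLinf \<le> L x y" and "0 < L x y" and "L x y \<le> (CLsup + 1) * \<xi>"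
proof -
  have *: "CLinf \<le> CLinf * \<xi>" "0 < CLsup * \<xi>"
    using CLinf_pos CLinf_le xi_ge_1 by (simp_all add: mult_le_cancel_left1)
  show 1: "min 1 CLinf \<le> L x y"
    using * by (cases rule: edge_cases[OF assms]) auto
  show "0 < L x y" using 1 CLinf_pos by (auto simp: min_def split: if_splits)
  show "L x y \<le> (CLsup + 1) * \<xi>"
    using * xi_ge_1 by (cases rule: edge_cases[OF assms]) (auto simp: algebra_simps)
qed

lemma inclusion_two_nodes: "i \<in> {1..Nch} \<Longrightarrow> \<exists>p q. {p, q} \<subseteq> R i \<and> p \<noteq> q"
  using inclusion_has_edge edges by blast

text \<open>
  This is what makes the entries of \<open>S\<close> on the inclusions of order \<open>\<xi>\<close>.
\<close>

lemma neighbor_in_inclusion: "i \<in> {1..Nch} \<Longrightarrow> x \<in> R i \<Longrightarrow> \<exists>y\<in>R i. {x, y} \<in> E"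
  using inclusion_two_nodes connected_edge_at[OF connected_inclusion] by blast

lemma neighbor: "x \<in> N \<Longrightarrow> \<exists>y. {x, y} \<in> E"
proof -
  assume x: "x \<in> N"
  have "1 \<in> {1..Nch}" using Nch_pos by simp
  then obtain p q where "{p, q} \<subseteq> N" "p \<noteq> q"
    using inclusion_two_nodes inclusion_subset by (meson subset_trans)
  then show ?thesis using connected_edge_at[OF connected_network _ _ x] by blast
qed

lemma weight_le_Ltilde:
  assumes "{x, y} \<in> E"
  shows "L x y / 2 \<le> Ltilde E L x"
proof -
  have "L x y \<le> (\<Sum>y\<in>nbrs E x. L x y)"
    using assms weight_bounds(2) less_imp_le finite_nbrs
    by (intro member_le_sum[of y "nbrs E x" "L x"]) (auto simp: nbrs_def)
  then show ?thesis by (simp add: Ltilde_def)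
qed

lemma S_diag_pos: "x \<in> N \<Longrightarrow> 0 < Ltilde E L x + M x"
  using neighbor[of x] weight_le_Ltilde[of x] weight_bounds(2)[of x] masses[of x] by fastforce

sublocale form_pair N "A_form N E L M" "S_form N E L M"
proof (rule form_pair.intro)
  fix v w :: "'a \<Rightarrow> real"
  show "A_form N E L M v w = A_form N E L M w v" by (simp add: A_form_def mult_ac)
  show "S_form N E L M v w = S_form N E L M w v" by (simp add: S_form_def mult_ac)
  show "0 < S_form N E L M v v" if v: "v \<in> node_funs N" "v \<noteq> 0"
  proof -
    obtain x where x: "v x \<noteq> 0" using v(2) by (auto simp: fun_eq_iff)
    then have "x \<in> N" using v(1) by (auto simp: node_funs_def)
    then show ?thesis
      unfolding S_form_def
    proof (rule sum_pos2[OF finite_nodes])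
      show "0 < (Ltilde E L x + M x) * v x * v x"
        using S_diag_pos[OF \<open>x \<in> N\<close>] x by (simp add: mult.assoc zero_less_mult_iff) linarith
      show "0 \<le> (Ltilde E L y + M y) * v y * v y" if "y \<in> N" for y
        using S_diag_pos[OF that] by (simp add: mult.assoc)
    qed
  qed
qed (rule finite_nodes linear_A_form linear_S_form)+

abbreviation "ev \<equiv> gen_eigenvalue N (A_op N E L M) (S_op N E L M)"

lemmas ev_le = eigenvalue_le_by_subspace[folded A_op_def S_op_def]
lemmas ev_ge = eigenvalue_ge_by_kernel[folded A_op_def S_op_def]

text \<open>
  Every edge occurs in the sum in both orientations.
\<close>

lemma edge_sum_endpoints:
  fixes W :: "'a \<Rightarrow> 'a \<Rightarrow> real" and f :: "'a \<Rightarrow> real"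
  assumes W: "\<And>x y. {x, y} \<in> E \<Longrightarrow> W x y = W y x"
  shows "(\<Sum>x\<in>N. \<Sum>y\<in>nbrs E x. W x y * (f x + f y)) = 2 * (\<Sum>x\<in>N. f x * (\<Sum>y\<in>nbrs E x. W x y))"
proof -
  have "(\<Sum>x\<in>N. \<Sum>y\<in>nbrs E x. W x y * f y) = (\<Sum>y\<in>N. \<Sum>x\<in>{x. x \<in> N \<and> {x, y} \<in> E}. W x y * f y)"
    unfolding nbrs_eq by (rule sum.swap_restrict[OF finite_nodes finite_nodes])
  also have "\<dots> = (\<Sum>y\<in>N. \<Sum>x\<in>nbrs E y. W y x * f y)"
    using W by (intro sum.cong) (auto simp: nbrs_eq insert_commute)
  finally have "(\<Sum>x\<in>N. \<Sum>y\<in>nbrs E x. W x y * f y) = (\<Sum>x\<in>N. \<Sum>y\<in>nbrs E x. W x y * f x)" .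
  then show ?thesis
    by (simp add: distrib_left sum.distrib sum_distrib_left mult_ac)
qed

text \<open>
  The weights \<open>W\<close> stand in for \<open>L\<close> in the energy estimate: \<open>W = L\<close> serves general functions, and
  \<open>W = 1\<close> those whose differences vanish on all heavy edges.
\<close>

lemma A_form_le_edge_sum:
  assumes W: "\<And>x y. {x, y} \<in> E \<Longrightarrow> W x y = W y x"
    and le: "\<And>x y. {x, y} \<in> E \<Longrightarrow> L x y * (v x - v y)\<^sup>2 \<le> W x y * (2 * (v x)\<^sup>2 + 2 * (v y)\<^sup>2)"
  shows "A_form N E L M v v \<le> (\<Sum>x\<in>N. (2 * (\<Sum>y\<in>nbrs E x. W x y) + M x) * (v x)\<^sup>2)"
proof -
  have "(\<Sum>x\<in>N. \<Sum>y\<in>nbrs E x. L x y * (v x - v y) * (v x - v y))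
      \<le> (\<Sum>x\<in>N. \<Sum>y\<in>nbrs E x. W x y * (2 * (v x)\<^sup>2 + 2 * (v y)\<^sup>2))"
    using le by (intro sum_mono) (auto simp: nbrs_def power2_eq_square mult.assoc)
  also have "\<dots> = 2 * (\<Sum>x\<in>N. 2 * (v x)\<^sup>2 * (\<Sum>y\<in>nbrs E x. W x y))"
    by (rule edge_sum_endpoints[OF W])
  finally have "A_form N E L M v v
      \<le> (\<Sum>x\<in>N. 2 * (v x)\<^sup>2 * (\<Sum>y\<in>nbrs E x. W x y)) + (\<Sum>x\<in>N. M x * v x * v x)"
    by (simp add: A_form_def)
  also have "\<dots> = (\<Sum>x\<in>N. (2 * (\<Sum>y\<in>nbrs E x. W x y) + M x) * (v x)\<^sup>2)"
    unfolding sum.distrib[symmetric]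
    by (intro sum.cong refl) (simp add: algebra_simps power2_eq_square)
  finally show ?thesis .
qed

lemma parallelogram_bound: "(p - q)\<^sup>2 \<le> 2 * p\<^sup>2 + 2 * q\<^sup>2" for p q :: real
  using zero_le_power2[of "p + q"] by (simp add: power2_eq_square algebra_simps)

lemma A_form_nonneg: "0 \<le> A_form N E L M v v"
proof -
  have "0 \<le> (\<Sum>x\<in>N. \<Sum>y\<in>nbrs E x. L x y * (v x - v y) * (v x - v y))"
    using weight_bounds(2) by (intro sum_nonneg) (auto simp: nbrs_def mult.assoc less_imp_le)
  moreover have "0 \<le> (\<Sum>x\<in>N. M x * v x * v x)"
    using masses by (intro sum_nonneg) (auto simp: mult.assoc)
  ultimately show ?thesis by (simp add: A_form_def)
qed

lemma A_form_le_S_form: "A_form N E L M v v \<le> 4 * S_form N E L M v v"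
proof -
  have "A_form N E L M v v \<le> (\<Sum>x\<in>N. (2 * (\<Sum>y\<in>nbrs E x. L x y) + M x) * (v x)\<^sup>2)"
    using weights_sym weight_bounds(2) parallelogram_bound
    by (intro A_form_le_edge_sum mult_left_mono) (auto simp: less_imp_le)
  also have "\<dots> \<le> (\<Sum>x\<in>N. 4 * (Ltilde E L x + M x) * (v x)\<^sup>2)"
    using masses by (intro sum_mono mult_right_mono) (auto simp: Ltilde_def)
  finally show ?thesis
    by (simp add: S_form_def sum_distrib_left mult_ac power2_eq_square)
qed

text \<open>
  Only edges of weight one see the differences of \<open>v\<close>, so the energy is at most of the order of the
  Euclidean norm; \<open>v\<close> lives on the inclusions, where the entries of \<open>S\<close> are at least \<open>CLinf * \<xi> / 2\<close>.
\<close>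

lemma inclusion_constant_rayleigh:
  assumes R1: "\<And>x. x \<in> R1 \<Longrightarrow> v x = 0"
    and const: "\<And>i x y. i \<in> {1..Nch} \<Longrightarrow> x \<in> R i \<Longrightarrow> y \<in> R i \<Longrightarrow> v x = v y"
  shows "A_form N E L M v v \<le> 2 * (2 * Ct + \<bar>Mbar\<bar>) / CLinf / \<xi> * S_form N E L M v v"
proof -
  define c where "c = 2 * Ct + \<bar>Mbar\<bar>"
  have pos: "0 < CLinf * \<xi>" using CLinf_pos xi_ge_1 by simp
  have "A_form N E L M v v \<le> (\<Sum>x\<in>N. (2 * (\<Sum>y\<in>nbrs E x. 1) + M x) * (v x)\<^sup>2)"
  proof (rule A_form_le_edge_sum)
    fix x y assume e: "{x, y} \<in> E"
    from e show "L x y * (v x - v y)\<^sup>2 \<le> 1 * (2 * (v x)\<^sup>2 + 2 * (v y)\<^sup>2)"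
    proof (cases rule: edge_cases)
      case plain
      then show ?thesis using parallelogram_bound by simp
    next
      case (high i)
      then have "v x = v y" by (intro const)
      then show ?thesis by simp
    qed
  qed simp
  also have "\<dots> \<le> (\<Sum>x\<in>N. c * (v x)\<^sup>2)"
  proof (intro sum_mono mult_right_mono)
    fix x assume x: "x \<in> N"
    show "2 * (\<Sum>y\<in>nbrs E x. 1) + M x \<le> c"
      using nbrs_bound[OF x] masses[OF x] by (simp add: c_def)
  qed simp
  also have "\<dots> \<le> (\<Sum>x\<in>N. 2 * c / (CLinf * \<xi>) * ((Ltilde E L x + M x) * v x * v x))"
  proof (intro sum_mono)
    fix x assume x: "x \<in> N"
    show "c * (v x)\<^sup>2 \<le> 2 * c / (CLinf * \<xi>) * ((Ltilde E L x + M x) * v x * v x)"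
    proof (cases "x \<in> R1")
      case True
      then show ?thesis using R1 by simp
    next
      case False
      then obtain i where i: "i \<in> {1..Nch}" "x \<in> R i" using x decomposition(1) by blast
      then obtain y where y: "y \<in> R i" "{x, y} \<in> E" using neighbor_in_inclusion by blast
      have "CLinf * \<xi> \<le> L x y" using weights_high[OF y(2)] i y by blast
      then have "CLinf * \<xi> / 2 \<le> Ltilde E L x + M x"
        using weight_le_Ltilde[OF y(2)] masses[OF x] by simp
      then have "1 \<le> 2 / (CLinf * \<xi>) * (Ltilde E L x + M x)"
        using pos by (simp add: field_simps)
      then have "c * (v x)\<^sup>2 * 1 \<le> c * (v x)\<^sup>2 * (2 / (CLinf * \<xi>) * (Ltilde E L x + M x))"
        using Ct_pos by (intro mult_left_mono) (simp_all add: c_def)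
      then show ?thesis by (simp add: power2_eq_square mult_ac)
    qed
  qed
  also have "\<dots> = 2 * c / CLinf / \<xi> * S_form N E L M v v"
    by (simp add: S_form_def sum_distrib_left)
  finally show ?thesis by (simp add: c_def)
qed

lemma independent_indicators:
  assumes "m \<le> Nch"
  shows "independent ((\<lambda>i. indicat_real (R i)) ` {1..m})" and "card ((\<lambda>i. indicat_real (R i)) ` {1..m}) = m"
proof -
  have rep: "\<exists>x. x \<in> R i" if "i \<in> {1..m}" for i
    using that assms connected_inclusion[of i] by (auto simp: graph_connected_def)
  have ind: "indicat_real (R j) x = (if i = j then 1 else 0)"
    if "i \<in> {1..m}" "j \<in> {1..m}" "x \<in> R i" for i j x
    using that assms disjoint_inclusions[of i j] by (auto simp: indicator_def)
  have inj: "inj_on (\<lambda>i. indicat_real (R i)) {1..m}"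
  proof (rule inj_onI)
    fix i j assume ij: "i \<in> {1..m}" "j \<in> {1..m}" and eq: "indicat_real (R i) = indicat_real (R j)"
    obtain x where "x \<in> R i" using rep ij by blast
    then show "i = j" using ind[OF ij(1) ij(1)] ind[OF ij] eq by (metis zero_neq_one)
  qed
  then show "card ((\<lambda>i. indicat_real (R i)) ` {1..m}) = m" by (simp add: card_image)
  show "independent ((\<lambda>i. indicat_real (R i)) ` {1..m})"
  proof (rule real_vector.independent_if_scalars_zero)
    fix k d
    assume sum: "(\<Sum>d\<in>(\<lambda>i. indicat_real (R i)) ` {1..m}. k d *\<^sub>R d) = 0"
      and "d \<in> (\<lambda>i. indicat_real (R i)) ` {1..m}"
    then obtain i where i: "i \<in> {1..m}" "d = indicat_real (R i)" by blast
    obtain x where x: "x \<in> R i" using rep i by blast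
    have "(\<Sum>j\<in>{1..m}. k (indicat_real (R j)) *\<^sub>R indicat_real (R j)) x = 0"
      using fun_cong[OF sum, of x] by (simp only: sum.reindex[OF inj] o_def zero_fun_apply)
    then have "(\<Sum>j\<in>{1..m}. k (indicat_real (R j)) * (if i = j then 1 else 0)) = 0"
      using ind[OF i(1) _ x] by (simp add: sum_fun_apply)
    then show "k d = 0" using i by (simp add: if_distrib cong: if_cong)
  qed simp
qed

lemma small_eigenvalues:
  assumes "m \<in> {1..Nch}"
  shows "ev m \<le> 2 * (2 * Ct + \<bar>Mbar\<bar>) / CLinf / \<xi>"
proof (rule ev_le)
  let ?C = "(\<lambda>i. indicat_real (R i)) ` {1..m}"
  let ?W = "{v \<in> node_funs N. (\<forall>x\<in>R1. v x = 0) \<and> (\<forall>i\<in>{1..Nch}. \<forall>x\<in>R i. \<forall>y\<in>R i. v x = v y)}"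
  have C: "?C \<subseteq> ?W"
  proof
    fix d assume "d \<in> ?C"
    then obtain i where "i \<in> {1..m}" and d: "d = indicat_real (R i)" by blast
    then have i: "i \<in> {1..Nch}" using assms by simp
    have "indicat_real (R i) x = indicat_real (R i) y"
      if "j \<in> {1..Nch}" "x \<in> R j" "y \<in> R j" for j x y
    proof (cases "i = j")
      case False
      then have "x \<notin> R i" "y \<notin> R i" using disjoint_inclusions[OF i that(1)] that(2,3) by blast+
      then show ?thesis by simp
    qed (use that in simp)
    moreover have "indicat_real (R i) x = 0" if "x \<in> R1" for x
    proof -
      have "x \<notin> R i" using that decomposition(2) i by blast
      then show ?thesis by simp
    qed
    moreover have "indicat_real (R i) \<in> node_funs N"
      unfolding node_funs_def using inclusion_subset[OF i] by (auto simp: indicator_def)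
    ultimately show "d \<in> ?W" unfolding d by blast
  qed
  show "independent ?C" "card ?C = m" using independent_indicators assms by auto
  show "?C \<subseteq> node_funs N" using C by blast
  show "1 \<le> m" using assms by simp
  fix v assume "v \<in> span ?C"
  moreover have "subspace ?W"
  proof (rule subspaceI)
    show "0 \<in> ?W" by (simp add: node_funs_def)
    show "u + w \<in> ?W" if u: "u \<in> ?W" and w: "w \<in> ?W" for u w
    proof (intro CollectI conjI ballI)
      show "u + w \<in> node_funs N" using u w by (intro subspace_add subspace_node_funs) blast+
      show "(u + w) x = 0" if "x \<in> R1" for x
        using u w that by simp
      show "(u + w) x = (u + w) y" if "i \<in> {1..Nch}" "x \<in> R i" "y \<in> R i" for i x y
      proof -
        have "u x = u y" "w x = w y" using u w that by blast+
        then show ?thesis by simp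
      qed
    qed
    show "k *\<^sub>R u \<in> ?W" if u: "u \<in> ?W" for k u
    proof (intro CollectI conjI ballI)
      show "k *\<^sub>R u \<in> node_funs N" using u by (intro subspace_scale subspace_node_funs) blast
      show "(k *\<^sub>R u) x = 0" if "x \<in> R1" for x
        using u that by simp
      show "(k *\<^sub>R u) x = (k *\<^sub>R u) y" if "i \<in> {1..Nch}" "x \<in> R i" "y \<in> R i" for i x y
      proof -
        have "u x = u y" using u that by blast
        then show ?thesis by simp
      qed
    qed
  qed
  ultimately have "v \<in> ?W" using span_minimal[OF C] by blast
  then show "A_form N E L M v v \<le> 2 * (2 * Ct + \<bar>Mbar\<bar>) / CLinf / \<xi> * S_form N E L M v v"
    by (intro inclusion_constant_rayleigh) blast+
qed

lemma eigenvalue_nonneg: "m \<in> {1..card N} \<Longrightarrow> 0 \<le> ev m"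
  using A_form_nonneg by (intro ev_ge[where J = "{}"]) auto

lemma eigenvalue_le_4:
  assumes "m \<in> {1..card N}"
  shows "ev m \<le> 4"
proof -
  obtain T where T: "T \<subseteq> delta ` N" "card T = m"
    using obtain_subset_with_card_n[of m "delta ` N"] assms by (auto simp: card_delta)
  show ?thesis
  proof (rule ev_le)
    show "independent T"
      using independent_delta[OF finite_nodes] T(1) by (rule real_vector.independent_mono)
    have "delta ` N \<subseteq> node_funs N" by (auto intro: delta_in_node_funs)
    with T(1) show "T \<subseteq> node_funs N" by (rule subset_trans)
  qed (use T assms A_form_le_S_form in auto)
qed

lemma Nch_less_card: "Nch + 1 \<le> card N"
proof -
  have fin: "finite (R i)" if "i \<in> {1..Nch}" for i
    using inclusion_subset[OF that] finite_nodes by (rule finite_subset)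
  have "2 \<le> card (R i)" if i: "i \<in> {1..Nch}" for i
  proof -
    obtain p q where pq: "{p, q} \<subseteq> R i" "p \<noteq> q" using inclusion_two_nodes[OF i] by blast
    have "card {p, q} \<le> card (R i)" by (rule card_mono[OF fin[OF i] pq(1)])
    then show ?thesis using pq(2) by simp
  qed
  then have "(\<Sum>i\<in>{1..Nch}. 2) \<le> (\<Sum>i\<in>{1..Nch}. card (R i))" by (intro sum_mono)
  also have "\<dots> = card (\<Union>i\<in>{1..Nch}. R i)"
    using fin disjoint_inclusions by (intro card_UN_disjoint[symmetric]) auto
  also have "\<dots> \<le> card N" using decomposition(1) by (intro card_mono finite_nodes) blast
  finally show ?thesis using Nch_pos by simp
qed

lemma edge_energy:
  assumes "{x, y} \<in> E"
  shows "L x y * (v x - v y)\<^sup>2 \<le> 2 * A_form N E L M v v"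
proof -
  define g where "g x y = L x y * (v x - v y) * (v x - v y)" for x y
  have g: "0 \<le> g x y" if "{x, y} \<in> E" for x y
    using weight_bounds(2)[OF that] by (simp add: g_def mult.assoc)
  have "g x y \<le> (\<Sum>y\<in>nbrs E x. g x y)"
    using assms g finite_nbrs by (intro member_le_sum[of y _ "g x"]) (auto simp: nbrs_def)
  also have "\<dots> \<le> (\<Sum>x\<in>N. \<Sum>y\<in>nbrs E x. g x y)"
    using edge_nodes[OF assms] g finite_nodes
    by (intro member_le_sum[of x _ "\<lambda>x. \<Sum>y\<in>nbrs E x. g x y"] sum_nonneg) (auto simp: nbrs_def)
  also have "\<dots> \<le> 2 * A_form N E L M v v"
    using masses by (auto simp: A_form_def g_def mult.assoc intro!: sum_nonneg)
  finally show ?thesis by (simp add: g_def power2_eq_square mult.assoc)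
qed

text \<open>
  The energy of a single edge bounds the difference across it by \<open>sqrt (2 (A v, v) / \<kappa>)\<close>, and at most
  \<open>D\<close> such differences lead from \<open>r\<close> to \<open>x\<close>. It is used on an inclusion with \<open>\<kappa>\<close> of order \<open>\<xi>\<close>, and on
  the whole network with \<open>\<kappa>\<close> of order one.
\<close>

lemma pinned_pointwise_bound:
  assumes P: "P \<subseteq> N" "graph_connected E P" "graph_diam E P \<le> D"
    and \<kappa>: "0 < \<kappa>" "\<And>x y. x \<in> P \<Longrightarrow> y \<in> P \<Longrightarrow> {x, y} \<in> E \<Longrightarrow> \<kappa> \<le> L x y"
    and r: "r \<in> P" "v r = 0" and x: "x \<in> P"
  shows "(v x)\<^sup>2 \<le> 2 * (real D)\<^sup>2 / \<kappa> * A_form N E L M v v"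
proof -
  define \<delta> where "\<delta> = sqrt (2 / \<kappa> * A_form N E L M v v)"
  have \<delta>: "0 \<le> \<delta>" using A_form_nonneg \<kappa>(1) by (simp add: \<delta>_def)
  have step: "\<bar>v y - v z\<bar> \<le> \<delta>" if "(y, z) \<in> adj E P" for y z
  proof -
    have e: "{y, z} \<in> E" "\<kappa> \<le> L y z" using that \<kappa>(2) by (auto simp: adj_def)
    have "\<kappa> * (v y - v z)\<^sup>2 \<le> L y z * (v y - v z)\<^sup>2" using e(2) by (intro mult_right_mono) auto
    also have "\<dots> \<le> 2 * A_form N E L M v v" by (rule edge_energy[OF e(1)])
    finally have "(v y - v z)\<^sup>2 \<le> 2 / \<kappa> * A_form N E L M v v"
      using \<kappa>(1) by (simp add: field_simps)
    then show ?thesis unfolding \<delta>_def by (rule real_le_rsqrt[of "\<bar>_\<bar>", simplified])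
  qed
  obtain k where k: "k \<le> D" "(r, x) \<in> adj E P ^^ k"
    using relpow_graph_diam[OF finite_subset[OF P(1) finite_nodes] P(2,3) r(1) x] by blast
  have "\<bar>v r - v x\<bar> \<le> real k * \<delta>" by (rule relpow_variation[OF step k(2)])
  also have "\<dots> \<le> real D * \<delta>" using k(1) \<delta> by (intro mult_right_mono) auto
  finally have "\<bar>v x\<bar>\<^sup>2 \<le> (real D * \<delta>)\<^sup>2" using r(2) by (intro power_mono) auto
  also have "\<dots> = 2 * (real D)\<^sup>2 / \<kappa> * A_form N E L M v v"
    using A_form_nonneg \<kappa>(1) by (simp add: \<delta>_def power_mult_distrib)
  finally show ?thesis by simp
qed

lemma Ltilde_le:
  assumes "x \<in> N" and "\<And>y. {x, y} \<in> E \<Longrightarrow> L x y \<le> c" and "0 \<le> c"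
  shows "Ltilde E L x \<le> Ct * c / 2"
proof -
  have "(\<Sum>y\<in>nbrs E x. L x y) \<le> real (card (nbrs E x)) * c"
    using assms(2) by (intro sum_bounded_above) (auto simp: nbrs_def)
  also have "\<dots> \<le> Ct * c" by (intro mult_right_mono nbrs_bound assms)
  finally show ?thesis by (simp add: Ltilde_def)
qed

text \<open>
  The first factor bounds the entries of \<open>S\<close> and the second one the squared values of \<open>v\<close> relative to
  \<open>(A v, v)\<close>, after the powers of \<open>\<xi>\<close> have cancelled.
\<close>

definition pinned_const :: real
  where "pinned_const = (Ct * (CLsup + 1) / 2 + \<bar>Mbar\<bar>) * (2 * (real D)\<^sup>2 / min 1 CLinf)"

lemma pinned_diagonal_bound:
  assumes r: "\<And>i. i \<in> {1..Nch} \<Longrightarrow> r i \<in> R i \<and> v (r i) = 0" and x: "x \<in> N"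
  shows "(Ltilde E L x + M x) * (v x)\<^sup>2 \<le> pinned_const * A_form N E L M v v"
proof -
  define q where "q = Ct * (CLsup + 1) / 2 + \<bar>Mbar\<bar>"
  define \<mu> where "\<mu> = min 1 CLinf"
  have \<mu>: "0 < \<mu>" using CLinf_pos by (simp add: \<mu>_def)
  have q: "0 \<le> q" using Ct_pos CLinf_pos CLinf_le by (simp add: q_def)
  \<comment> \<open>\<open>t\<close> is the local scale of the weights: \<open>1\<close> on \<open>R1\<close> and \<open>\<xi>\<close> on the inclusions.\<close>
  have key: "(Ltilde E L x + M x) * (v x)\<^sup>2 \<le> pinned_const * A_form N E L M v v"
    if t: "0 < t" and S: "Ltilde E L x + M x \<le> q * t"
      and V: "(v x)\<^sup>2 \<le> 2 * (real D)\<^sup>2 / (\<mu> * t) * A_form N E L M v v" for t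
  proof -
    have "(Ltilde E L x + M x) * (v x)\<^sup>2 \<le> q * t * (2 * (real D)\<^sup>2 / (\<mu> * t) * A_form N E L M v v)"
      using S V q t by (intro mult_mono) auto
    also have "\<dots> = pinned_const * A_form N E L M v v"
      using t by (simp add: pinned_const_def q_def \<mu>_def)
    finally show ?thesis .
  qed
  show ?thesis
  proof (cases "x \<in> R1")
    case True
    have "Ltilde E L x \<le> Ct * (CLsup + 1) / 2"
      using weights_R1[OF _ True] CLinf_pos CLinf_le by (intro Ltilde_le[OF x]) auto
    moreover have "(v x)\<^sup>2 \<le> 2 * (real D)\<^sup>2 / \<mu> * A_form N E L M v v"
    \<comment> \<open>Any chosen node will do here, since all edges have weight at least \<open>\<mu>\<close>.\<close>
    proof (rule pinned_pointwise_bound[OF subset_refl connected_network network_diam \<mu> _ _ _ x])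
      show "r 1 \<in> N" "v (r 1) = 0" using r[of 1] inclusion_subset[of 1] Nch_pos by auto
    qed (auto simp: \<mu>_def weight_bounds(1)[unfolded \<mu>_def])
    ultimately show ?thesis using masses[OF x] by (intro key[of 1]) (auto simp: q_def)
  next
    case False
    then obtain i where i: "i \<in> {1..Nch}" "x \<in> R i" using x decomposition(1) by blast
    have "Ltilde E L x \<le> Ct * ((CLsup + 1) * \<xi>) / 2"
      using weight_bounds(3) CLinf_pos CLinf_le xi_ge_1 by (intro Ltilde_le[OF x]) auto
    moreover have "M x \<le> \<bar>Mbar\<bar> * \<xi>"
      using masses[OF x] xi_ge_1 mult_left_mono[of 1 \<xi> "\<bar>Mbar\<bar>"] by simp
    ultimately have S: "Ltilde E L x + M x \<le> q * \<xi>" by (simp add: q_def algebra_simps add_divide_distrib)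
    \<comment> \<open>The path from \<open>r i\<close> must stay inside the inclusion to gain the factor \<open>1 / \<xi>\<close>.\<close>
    have "(v x)\<^sup>2 \<le> 2 * (real D)\<^sup>2 / (\<mu> * \<xi>) * A_form N E L M v v"
    proof (rule pinned_pointwise_bound[where r = "r i", OF inclusion_subset connected_inclusion inclusion_diam _ _ _ _ i(2)])
      show "0 < \<mu> * \<xi>" using \<mu> xi_ge_1 by simp
      show "\<mu> * \<xi> \<le> L y z" if "y \<in> R i" "z \<in> R i" "{y, z} \<in> E" for y z
      proof -
        have "\<mu> * \<xi> \<le> CLinf * \<xi>" using xi_ge_1 by (intro mult_right_mono) (auto simp: \<mu>_def)
        also have "\<dots> \<le> L y z" using weights_high[OF that(3)] that i(1) by blast
        finally show ?thesis .
      qed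
    qed (use r[OF i(1)] i in auto)
    with S xi_ge_1 show ?thesis by (intro key[of \<xi>]) auto
  qed
qed

lemma large_eigenvalues:
  assumes m: "m \<in> {Nch + 1..card N}"
  shows "1 / (real (\<Sum>k\<le>D. nat \<lceil>Ct\<rceil> ^ k) * (pinned_const + 1)) \<le> ev m"
proof -
  define n where "n = (\<Sum>k\<le>D. nat \<lceil>Ct\<rceil> ^ k)"
  have pinned: "0 \<le> pinned_const"
    using Ct_pos CLinf_pos CLinf_le by (simp add: pinned_const_def)
  have n: "card N \<le> n"
    unfolding n_def
  proof (rule card_le_degree_diam[OF finite_nodes _ connected_network network_diam])
    fix x assume "x \<in> N"
    then show "finite (nbrs E x) \<and> card (nbrs E x) \<le> nat \<lceil>Ct\<rceil>"
      using nbrs_bound[of x] finite_nbrs by (simp add: le_nat_iff le_ceiling_iff)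
  qed
  have n_pos: "0 < n" using n Nch_less_card by simp
  define r where "r i = (SOME x. x \<in> R i)" for i
  have r: "r i \<in> R i" if "i \<in> {1..Nch}" for i
    using connected_inclusion[OF that] by (simp add: r_def graph_connected_def some_in_eq)
  show ?thesis
    unfolding n_def[symmetric]
  proof (rule ev_ge[where J = "{1..Nch}" and f = "\<lambda>i v. v (r i)"])
    show "linear (\<lambda>v::'a \<Rightarrow> real. v (r i))" for i by (rule linearI) auto
    fix v :: "'a \<Rightarrow> real" assume v: "\<forall>i\<in>{1..Nch}. v (r i) = 0"
    have "S_form N E L M v v \<le> (\<Sum>x\<in>N. pinned_const * A_form N E L M v v)"
      unfolding S_form_def using r v pinned_diagonal_bound[of r v]
      by (intro sum_mono) (auto simp: power2_eq_square mult.assoc)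
    also have "\<dots> \<le> real n * (pinned_const + 1) * A_form N E L M v v"
      using n pinned A_form_nonneg[of v] by (auto simp: mult.assoc intro!: mult_mono)
    finally show "1 / (real n * (pinned_const + 1)) * S_form N E L M v v \<le> A_form N E L M v v"
      using n_pos pinned by (simp add: divide_le_eq mult_ac)
  qed (use m in auto)
qed

end

theorem mainTheorem2:
  fixes Ct CLinf CLsup Mbar :: real and D K :: nat
  assumes "0 < Ct" and "0 < CLinf" and "CLinf \<le> CLsup"
  shows "\<exists>C\<^sub>1 C C\<^sub>2. 0 < C\<^sub>1 \<and> 0 < C \<and> 0 < C\<^sub>2 \<and>
    (\<forall>\<xi>\<ge>1. \<forall>(N :: 'a set) E R1 Nch R L M.
      high_contrast_network Ct D K CLinf CLsup Mbar \<xi> N E R1 Nch R L M \<longrightarrow>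
      (let ev = gen_eigenvalue N (A_op N E L M) (S_op N E L M) in
        (\<forall>m\<in>{1..Nch}. \<bar>ev m\<bar> \<le> C\<^sub>1 / \<xi>) \<and>
        (\<forall>m\<in>{Nch + 1..card N}. C \<le> ev m) \<and>
        ev (Nch + 1) \<le> C\<^sub>2))"
proof -
  define C\<^sub>1 where "C\<^sub>1 = 2 * (2 * Ct + \<bar>Mbar\<bar>) / CLinf"
  \<comment> \<open>the value of \<open>pinned_const\<close>, named before any network is given\<close>
  define p where "p = (Ct * (CLsup + 1) / 2 + \<bar>Mbar\<bar>) * (2 * (real D)\<^sup>2 / min 1 CLinf)"
  define C where "C = 1 / (real (\<Sum>k\<le>D. nat \<lceil>Ct\<rceil> ^ k) * (p + 1))"
  show ?thesis
  proof (rule exI[of _ C\<^sub>1], rule exI[of _ C], rule exI[of _ 4], intro conjI allI impI)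
    show "0 < C\<^sub>1" using assms by (simp add: C\<^sub>1_def)
    have "0 \<le> p" using assms by (simp add: p_def)
    moreover have "0 < (\<Sum>k\<le>D. nat \<lceil>Ct\<rceil> ^ k)"
      by (intro sum_pos2[of _ 0]) auto
    ultimately show "0 < C" by (simp add: C_def del: of_nat_sum)
    fix \<xi> :: real and N :: "'a set" and E R1 Nch R L M
    assume "1 \<le> \<xi>" and "high_contrast_network Ct D K CLinf CLsup Mbar \<xi> N E R1 Nch R L M"
    then interpret contrast_regime Ct D K CLinf CLsup Mbar \<xi> N E R1 Nch R L M
      using assms by (simp add: contrast_regime_def contrast_regime_axioms_def)
    have "\<bar>ev m\<bar> \<le> C\<^sub>1 / \<xi>" if "m \<in> {1..Nch}" for m
      using small_eigenvalues[OF that] eigenvalue_nonneg[of m] that Nch_less_card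
      by (simp add: C\<^sub>1_def)
    moreover have "C \<le> ev m" if "m \<in> {Nch + 1..card N}" for m
      using large_eigenvalues[OF that] by (simp add: C_def p_def pinned_const_def)
    moreover have "ev (Nch + 1) \<le> 4"
      using Nch_less_card by (intro eigenvalue_le_4) auto
    ultimately show "let ev = gen_eigenvalue N (A_op N E L M) (S_op N E L M) in
        (\<forall>m\<in>{1..Nch}. \<bar>ev m\<bar> \<le> C\<^sub>1 / \<xi>) \<and> (\<forall>m\<in>{Nch + 1..card N}. C \<le> ev m) \<and> ev (Nch + 1) \<le> 4"
      unfolding Let_def by blast
  qed simp
qed

end
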